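(* Under the hard-cluster flat model with parameters $(N,K,\tau)$, as $N\to\infty$, weak detection is impossible in each of the following regimes. (i) $K\ge2$ fixed and $\tau=\omega\big(N^{-1-\frac1{K-1}}\big)$. (ii) $K=N^\alpha$ with $0<\alpha<1/2$, and $\tau=\frac{K^2}{\epsilon N\log N}$ for any constant $\epsilon\in(0,1-2\alpha)$.
   Context: Hard-cluster flat model $(N,K,\tau)$, with $1\le K\le N$ an integer and $\tau\in(0,1)$ (both possibly depending on $N$): angles $X=(X_1,\dots,X_N)\in[0,2\pi)^N$ are observed. Under $H_0$ (law $\mathbb{Q}$) the $X_i$ are i.i.d. uniform on $[0,2\pi)$. Under $H_1$ (law $\mathbb{P}$), a subset $S^*\subset[N]$ is drawn uniformly at random among subsets of size $K$, a phase $\Theta^*$ is drawn independently and uniformly on $[0,2\pi)$, and given $(S^*,\Theta^* )$ the $X_i$ are independent with $X_i$ uniform on the arc $[\Theta^*,\Theta^*+2\pi\tau]$ (mod $2\pi$) for $i\in S^*$ and $X_i$ uniform on $[0,2\pi)$ for $i\notin S^*$. $\mathbb{P}$ is the resulting mixture law of $X$. $K=N^\alpha$ is understood up to rounding to an integer. $a_N=\omega(b_N)$ means $a_N/b_N\to\infty$. $\log$ is the natural logarithm. A test is a measurable function $\phi$ of the data with values in $\{0,1\}$ ($1$ means reject $H_0$). $p_{\mathrm{fa}}(\phi)=\mathbb{Q}\{\phi(X)=1\}$ and $p_{\mathrm{miss}}(\phi)=\mathbb{P}\{\phi(X)=0\}$. Weak detection is impossible if every sequence of tests satisfies $p_{\mathrm{fa}}+p_{\mathrm{miss}}\ge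 1-o(1)$; equivalently the total variation distance between $\mathbb{P}$ and $\mathbb{Q}$ tends to $0$. *)

theory Defs
  imports "HOL-Probability.Probability" "HOL-Library.Real_Mod"
begin

definition circle :: "real measure" where
  "circle = restrict_space lborel {0..<2 * pi}"

definition circ_arc :: "real \<Rightarrow> real \<Rightarrow> real set" where
  "circ_arc \<theta> \<tau> = (\<lambda>t. t rmod (2 * pi)) ` {\<theta>..\<theta> + 2 * pi * \<tau>}"

definition hc_null :: "nat \<Rightarrow> (nat \<Rightarrow> real) measure" where
  "hc_null N = (\<Pi>\<^sub>M i\<in>{1..N}. uniform_measure circle {0..<2 * pi})"

definition hc_cond :: "nat \<Rightarrow> real \<Rightarrow> nat set \<Rightarrow> real \<Rightarrow> (nat \<Rightarrow> real) measure" where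
  "hc_cond N \<tau> S \<theta> =
     (\<Pi>\<^sub>M i\<in>{1..N}. uniform_measure circle (if i \<in> S then circ_arc \<theta> \<tau> else {0..<2 * pi}))"

definition hc_alt :: "nat \<Rightarrow> nat \<Rightarrow> real \<Rightarrow> (nat \<Rightarrow> real) measure" where
  "hc_alt N K \<tau> = do {
     S \<leftarrow> measure_pmf (pmf_of_set {S. S \<subseteq> {1..N} \<and> card S = K});
     \<theta> \<leftarrow> uniform_measure circle {0..<2 * pi};
     hc_cond N \<tau> S \<theta>
   }"

definition is_test :: "nat \<Rightarrow> ((nat \<Rightarrow> real) \<Rightarrow> nat) \<Rightarrow> bool" where
  "is_test N \<phi> \<longleftrightarrow> \<phi> \<in> (\<Pi>\<^sub>M i\<in>{1..N}. circle) \<rightarrow>\<^sub>M count_space {0, 1}"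

definition p_fa :: "nat \<Rightarrow> ((nat \<Rightarrow> real) \<Rightarrow> nat) \<Rightarrow> real" where
  "p_fa N \<phi> = measure (hc_null N) {x \<in> space (hc_null N). \<phi> x = 1}"

definition p_miss :: "nat \<Rightarrow> nat \<Rightarrow> real \<Rightarrow> ((nat \<Rightarrow> real) \<Rightarrow> nat) \<Rightarrow> real" where
  "p_miss N K \<tau> \<phi> = measure (hc_alt N K \<tau>) {x \<in> space (hc_alt N K \<tau>). \<phi> x = 0}"

text \<open>
  The model is only meaningful for \<open>1 \<le> K N \<le> N\<close> and \<open>0 < \<tau> N < 1\<close>. Only large \<open>N\<close> matter
  here, so it suffices that these hold eventually.
\<close>

definition weak_detection_impossible :: "(nat \<Rightarrow> nat) \<Rightarrow> (nat \<Rightarrow> real) \<Rightarrow> bool" where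
  "weak_detection_impossible K \<tau> \<longleftrightarrow>
     (\<forall>\<phi>. (\<forall>N. is_test N (\<phi> N)) \<longrightarrow>
        (\<exists>e :: nat \<Rightarrow> real. e \<in> o(\<lambda>_. 1) \<and>
           (\<forall>\<^sub>F N in sequentially. p_fa N (\<phi> N) + p_miss N (K N) (\<tau> N) (\<phi> N) \<ge> 1 - e N)))"

subsection \<open>The laws are probability measures\<close>

text \<open>
  For \<open>0 < \<tau> < 1\<close> the kernels in \<open>hc_alt\<close> are measurable, so the Giry bind computes the
  iterated integral \<open>emeasure_hc_alt\<close>.
\<close>

lemma space_circle [simp]: "space circle = {0..<2 * pi}"
  by (simp add: circle_def space_restrict_space)

lemma circle_in_sets_circle [measurable]: "{0..<2 * pi} \<in> sets circle"
  using sets.top[of circle] by simp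

lemma emeasure_circle:
  assumes "A \<in> sets borel" "A \<subseteq> {0..<2 * pi}"
  shows "emeasure circle A = emeasure lborel A"
  using assms by (simp add: circle_def emeasure_restrict_space)

lemma emeasure_circle_total [simp]: "emeasure circle {0..<2 * pi} = ennreal (2 * pi)"
  by (subst emeasure_circle) auto

lemma circ_arc_eq:
  assumes "0 \<le> \<theta>" "\<theta> < 2 * pi" "0 < \<tau>" "\<tau> < 1"
  shows "circ_arc \<theta> \<tau> = {x \<in> {0..<2 * pi}.
           (\<theta> \<le> x \<and> x \<le> \<theta> + 2 * pi * \<tau>) \<or> x \<le> \<theta> + 2 * pi * \<tau> - 2 * pi}"
proof -
  have lt: "2 * pi * \<tau> < 2 * pi" using assms by simp
  have r1: "t rmod (2 * pi) = t" if "0 \<le> t" "t < 2 * pi" for t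
    using that by (intro rmod_idem) auto
  have r2: "t rmod (2 * pi) = t - 2 * pi" if "2 * pi \<le> t" "t < 4 * pi" for t
    using that by (intro rmod_unique[where n = 1]) auto
  show ?thesis
  proof (intro equalityI subsetI)
    fix x assume "x \<in> circ_arc \<theta> \<tau>"
    then obtain t where t: "\<theta> \<le> t" "t \<le> \<theta> + 2 * pi * \<tau>" "x = t rmod (2 * pi)"
      by (auto simp: circ_arc_def)
    show "x \<in> {x \<in> {0..<2 * pi}.
           (\<theta> \<le> x \<and> x \<le> \<theta> + 2 * pi * \<tau>) \<or> x \<le> \<theta> + 2 * pi * \<tau> - 2 * pi}"
    proof (cases "t < 2 * pi")
      case True
      then show ?thesis using t assms r1[of t] by auto
    next
      case False
      moreover have "t < 4 * pi" using t assms(2) lt by linarith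
      ultimately have "x = t - 2 * pi" "2 * pi \<le> t" "t < 4 * pi" using t r2[of t] by auto
      then show ?thesis using t(2) by auto
    qed
  next
    fix x assume x: "x \<in> {x \<in> {0..<2 * pi}.
           (\<theta> \<le> x \<and> x \<le> \<theta> + 2 * pi * \<tau>) \<or> x \<le> \<theta> + 2 * pi * \<tau> - 2 * pi}"
    show "x \<in> circ_arc \<theta> \<tau>"
    proof (cases "\<theta> \<le> x \<and> x \<le> \<theta> + 2 * pi * \<tau>")
      case True
      then show ?thesis using x r1[of x] unfolding circ_arc_def by force
    next
      case False
      then have "x + 2 * pi \<in> {\<theta>..\<theta> + 2 * pi * \<tau>}" using x assms by auto
      moreover have "(x + 2 * pi) rmod (2 * pi) = x" using x r2[of "x + 2 * pi"] by auto
      ultimately show ?thesis unfolding circ_arc_def by (metis image_eqI)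
    qed
  qed
qed

lemma circ_arc_subset: "circ_arc \<theta> \<tau> \<subseteq> {0..<2 * pi}"
  by (auto simp: circ_arc_def rmod_nonneg rmod_less)

lemma circ_arc_borel:
  assumes "0 \<le> \<theta>" "\<theta> < 2 * pi" "0 < \<tau>" "\<tau> < 1"
  shows "circ_arc \<theta> \<tau> \<in> sets borel"
  unfolding circ_arc_eq[OF assms] by measurable

lemma circ_arc_sets_circle:
  assumes "0 \<le> \<theta>" "\<theta> < 2 * pi" "0 < \<tau>" "\<tau> < 1"
  shows "circ_arc \<theta> \<tau> \<in> sets circle"
  using circ_arc_borel[OF assms] circ_arc_subset
  by (auto simp: circle_def sets_restrict_space image_iff)

lemma emeasure_circ_arc:
  assumes "0 \<le> \<theta>" "\<theta> < 2 * pi" "0 < \<tau>" "\<tau> < 1"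
  shows "emeasure circle (circ_arc \<theta> \<tau>) = ennreal (2 * pi * \<tau>)"
proof -
  have lt: "2 * pi * \<tau> < 2 * pi" and pos: "0 < 2 * pi * \<tau>" using assms by simp_all
  have "emeasure lborel (circ_arc \<theta> \<tau>) = ennreal (2 * pi * \<tau>)"
  proof (cases "\<theta> + 2 * pi * \<tau> < 2 * pi")
    case True
    then have "circ_arc \<theta> \<tau> = {\<theta>..\<theta> + 2 * pi * \<tau>}"
      unfolding circ_arc_eq[OF assms] using assms by auto
    then show ?thesis using pos by simp
  next
    case False
    then have "circ_arc \<theta> \<tau> = {\<theta>..<2 * pi} \<union> {0..\<theta> + 2 * pi * \<tau> - 2 * pi}"
      unfolding circ_arc_eq[OF assms] using assms(1,2) lt
      by (intro set_eqI) (simp only: Un_iff mem_Collect_eq atLeastLessThan_iff atLeastAtMost_iff, linarith)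
    moreover have "{\<theta>..<2 * pi} \<inter> {0..\<theta> + 2 * pi * \<tau> - 2 * pi} = {}"
      using lt unfolding disjoint_iff atLeastLessThan_iff atLeastAtMost_iff
      by (intro allI) linarith
    ultimately have "emeasure lborel (circ_arc \<theta> \<tau>) =
        emeasure lborel {\<theta>..<2 * pi} + emeasure lborel {0..\<theta> + 2 * pi * \<tau> - 2 * pi}"
      by (simp add: plus_emeasure)
    also have "\<dots> = ennreal (2 * pi * \<tau>)"
      using assms False by (simp add: ennreal_plus[symmetric] del: ennreal_plus)
    finally show ?thesis .
  qed
  then show ?thesis
    using emeasure_circle[OF circ_arc_borel[OF assms] circ_arc_subset] by simp
qed

lemma prob_space_uniform_circle: "prob_space (uniform_measure circle {0..<2 * pi})"
  by (rule prob_space_uniform_measure) auto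

lemma prob_space_uniform_circ_arc:
  assumes "0 \<le> \<theta>" "\<theta> < 2 * pi" "0 < \<tau>" "\<tau> < 1"
  shows "prob_space (uniform_measure circle (circ_arc \<theta> \<tau>))"
  by (rule prob_space_uniform_measure) (use assms in \<open>auto simp: emeasure_circ_arc\<close>)

lemma sets_hc_cond: "sets (hc_cond N \<tau> S \<theta>) = sets (\<Pi>\<^sub>M i\<in>{1..N}. circle)"
  unfolding hc_cond_def by (intro sets_PiM_cong) auto

lemma prob_space_hc_null: "prob_space (hc_null N)"
  unfolding hc_null_def by (intro prob_space_PiM prob_space_uniform_circle)

lemma prob_space_hc_cond:
  assumes "0 \<le> \<theta>" "\<theta> < 2 * pi" "0 < \<tau>" "\<tau> < 1"
  shows "prob_space (hc_cond N \<tau> S \<theta>)"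
  unfolding hc_cond_def
  by (intro prob_space_PiM) (auto intro: prob_space_uniform_circle prob_space_uniform_circ_arc assms)

lemma measurable_uniform_circ_arc:
  assumes "0 < \<tau>" "\<tau> < 1" and A: "A \<in> sets circle"
  shows "(\<lambda>\<theta>. emeasure (uniform_measure circle (circ_arc \<theta> \<tau>)) A) \<in> borel_measurable circle"
proof -
  have A': "A \<in> sets borel" "A \<subseteq> {0..<2 * pi}"
    using A by (auto simp: circle_def sets_restrict_space)
  define Q where "Q = {p :: real \<times> real. 0 \<le> snd p \<and> snd p < 2 * pi \<and> snd p \<in> A \<and>
     ((fst p \<le> snd p \<and> snd p \<le> fst p + 2 * pi * \<tau>) \<or> snd p \<le> fst p + 2 * pi * \<tau> - 2 * pi)}"
  have [measurable]: "A \<in> sets borel" by fact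
  have "Q = {p \<in> space (borel \<Otimes>\<^sub>M borel). 0 \<le> snd p \<and> snd p < 2 * pi \<and> snd p \<in> A \<and>
     ((fst p \<le> snd p \<and> snd p \<le> fst p + 2 * pi * \<tau>) \<or> snd p \<le> fst p + 2 * pi * \<tau> - 2 * pi)}"
    by (auto simp: Q_def space_pair_measure)
  also have "\<dots> \<in> sets (borel \<Otimes>\<^sub>M borel)" by measurable
  finally have "Q \<in> sets (borel \<Otimes>\<^sub>M lborel)" by (simp cong: sets_pair_measure_cong)
  then have m: "(\<lambda>\<theta>. emeasure lborel (Pair \<theta> -` Q)) \<in> borel_measurable borel"
    by (rule lborel.measurable_emeasure_Pair)
  have "(\<lambda>\<theta>. emeasure lborel (Pair \<theta> -` Q) / ennreal (2 * pi * \<tau>)) \<in> borel_measurable circle"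
    unfolding circle_def by (rule measurable_restrict_space1) (use m in measurable)
  moreover have "emeasure (uniform_measure circle (circ_arc \<theta> \<tau>)) A =
      emeasure lborel (Pair \<theta> -` Q) / ennreal (2 * pi * \<tau>)" if "\<theta> \<in> space circle" for \<theta>
  proof -
    have \<theta>: "0 \<le> \<theta>" "\<theta> < 2 * pi" using that by auto
    note ar = \<theta> assms(1,2)
    have "circ_arc \<theta> \<tau> \<inter> A = Pair \<theta> -` Q"
      using A' unfolding circ_arc_eq[OF ar] Q_def by auto
    moreover have "emeasure circle (circ_arc \<theta> \<tau> \<inter> A) = emeasure lborel (circ_arc \<theta> \<tau> \<inter> A)"
      by (rule emeasure_circle) (use A' circ_arc_borel[OF ar] in auto)
    ultimately show ?thesis
      using circ_arc_sets_circle[OF ar] A by (simp add: emeasure_circ_arc[OF ar])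
  qed
  ultimately show ?thesis by (subst measurable_cong) auto
qed

lemma measurable_hc_cond:
  assumes \<tau>: "0 < \<tau>" "\<tau> < 1"
  shows "hc_cond N \<tau> S \<in> circle \<rightarrow>\<^sub>M prob_algebra (\<Pi>\<^sub>M i\<in>{1..N}. circle)"
proof (rule measurable_prob_algebra_generated)
  show "sets (\<Pi>\<^sub>M i\<in>{1..N}. circle) =
      sigma_sets (\<Pi>\<^sub>E i\<in>{1..N}. space circle) (prod_algebra {1..N} (\<lambda>_. circle))"
    by (rule sets_PiM)
  show "Int_stable (prod_algebra {1..N} (\<lambda>_. circle))"
    by (rule Int_stable_prod_algebra)
  show "prod_algebra {1..N} (\<lambda>_. circle) \<subseteq> Pow (\<Pi>\<^sub>E i\<in>{1..N}. space circle)"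
    by (rule prod_algebra_sets_into_space)
next
  fix \<theta> assume "\<theta> \<in> space circle"
  then show "prob_space (hc_cond N \<tau> S \<theta>)" by (intro prob_space_hc_cond \<tau>) auto
next
  fix \<theta> show "sets (hc_cond N \<tau> S \<theta>) = sets (\<Pi>\<^sub>M i\<in>{1..N}. circle)" by (rule sets_hc_cond)
next
  fix B assume "B \<in> prod_algebra {1..N} (\<lambda>_. circle)"
  then obtain X where B: "B = Pi\<^sub>E {1..N} X" and X: "\<And>i. i \<in> {1..N} \<Longrightarrow> X i \<in> sets circle"
    by (auto simp only: prod_algebra_eq_finite[OF finite_atLeastAtMost] Pi_iff)
  let ?M = "\<lambda>\<theta> i. uniform_measure circle (if i \<in> S then circ_arc \<theta> \<tau> else {0..<2 * pi})"
  have "emeasure (hc_cond N \<tau> S \<theta>) B = (\<Prod>i\<in>{1..N}. emeasure (?M \<theta> i) (X i))"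
    if "\<theta> \<in> space circle" for \<theta>
  proof -
    have p: "prob_space (?M \<theta> i)" for i
      using that by (auto intro: prob_space_uniform_circle prob_space_uniform_circ_arc \<tau>)
    interpret product_prob_space "?M \<theta>"
      by (intro product_prob_spaceI p)
    show ?thesis unfolding hc_cond_def B
      by (rule emeasure_PiM) (use X in auto)
  qed
  moreover have "(\<lambda>\<theta>. \<Prod>i\<in>{1..N}. emeasure (?M \<theta> i) (X i)) \<in> borel_measurable circle"
  proof (rule borel_measurable_prod_ennreal)
    fix i assume "i \<in> {1..N}"
    then show "(\<lambda>\<theta>. emeasure (?M \<theta> i) (X i)) \<in> borel_measurable circle"
      using measurable_uniform_circ_arc[OF \<tau> X] by (cases "i \<in> S") auto
  qed
  ultimately show "(\<lambda>\<theta>. emeasure (hc_cond N \<tau> S \<theta>) B) \<in> borel_measurable circle"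
    by (subst measurable_cong) auto
qed

lemma
  assumes \<tau>: "0 < \<tau>" "\<tau> < 1"
  shows prob_space_hc_alt: "prob_space (hc_alt N K \<tau>)"
    and sets_hc_alt: "sets (hc_alt N K \<tau>) = sets (\<Pi>\<^sub>M i\<in>{1..N}. circle)"
    and emeasure_hc_alt: "\<And>A. A \<in> sets (\<Pi>\<^sub>M i\<in>{1..N}. circle) \<Longrightarrow> emeasure (hc_alt N K \<tau>) A =
      (\<integral>\<^sup>+S. \<integral>\<^sup>+\<theta>. emeasure (hc_cond N \<tau> S \<theta>) A \<partial>uniform_measure circle {0..<2 * pi}
         \<partial>measure_pmf (pmf_of_set {S. S \<subseteq> {1..N} \<and> card S = K}))"
proof -
  let ?P = "measure_pmf (pmf_of_set {S. S \<subseteq> {1..N} \<and> card S = K})"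
  let ?U = "uniform_measure circle {0..<2 * pi}"
  let ?L = "\<Pi>\<^sub>M i\<in>{1..N}. circle"
  have U: "?U \<in> space (prob_algebra circle)"
    by (simp add: space_prob_algebra prob_space_uniform_circle)
  have P: "?P \<in> space (prob_algebra (count_space UNIV))"
    by (simp add: space_prob_algebra measure_pmf.prob_space_axioms)
  have inner: "?U \<bind> hc_cond N \<tau> S \<in> space (prob_algebra ?L)" for S
    by (rule measurable_space[OF measurable_bind_prob_space[OF measurable_const[OF U] measurable_hc_cond[OF \<tau>]], of undefined "count_space UNIV"]) simp
  have k: "(\<lambda>S. ?U \<bind> hc_cond N \<tau> S) \<in> count_space UNIV \<rightarrow>\<^sub>M prob_algebra ?L"
    using inner by auto
  have "hc_alt N K \<tau> \<in> space (prob_algebra ?L)"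
    unfolding hc_alt_def
    by (rule measurable_space[OF measurable_bind_prob_space[OF measurable_const[OF P] k], of undefined "count_space UNIV"]) simp
  then show "prob_space (hc_alt N K \<tau>)" "sets (hc_alt N K \<tau>) = sets ?L"
    by (auto simp: space_prob_algebra)
  fix A assume A: "A \<in> sets ?L"
  show "emeasure (hc_alt N K \<tau>) A = (\<integral>\<^sup>+S. \<integral>\<^sup>+\<theta>. emeasure (hc_cond N \<tau> S \<theta>) A \<partial>?U \<partial>?P)"
    unfolding hc_alt_def emeasure_bind_prob_algebra[OF P k A]
    by (intro nn_integral_cong emeasure_bind_prob_algebra[OF U measurable_hc_cond[OF \<tau>] A])
qed

end

theory Submission
  imports Defs "HOL-Real_Asymp.Real_Asymp"
begin

text \<open>
  The proof bounds the \<open>\<chi>\<^sup>2\<close>-divergence of the alternative from the null law. Given the planted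
  set \<open>S\<close> and the phase \<open>\<theta>\<close>, the data have the likelihood ratio
  \<open>\<Prod>i\<in>S. 1[x i \<in> arc \<theta>] / \<tau>\<close> with respect to the uniform law, and the likelihood ratio \<open>L\<close> of the
  alternative is the average of these. By Cauchy--Schwarz a rejection region has probabilities under
  the two laws that differ by at most the root of \<open>E L\<^sup>2 - 1\<close>, so the errors of any test add up to at
  least \<open>1 - sqrt (E L\<^sup>2 - 1)\<close>, and it suffices that \<open>E L\<^sup>2 \<longlongrightarrow> 1\<close>.

  Expanding the square introduces two independent copies \<open>(S, \<theta>)\<close> and \<open>(S', \<theta>')\<close> of the latent
  variables. The coordinates are independent under the null law, and only those in \<open>S \<inter> S'\<close> see both
  arcs, so \<open>E L\<^sup>2\<close> is the mean of \<open>o (\<theta>, \<theta>')\<close> to the power \<open>r = card (S \<inter> S')\<close>, where \<open>o\<close> is the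
  fraction of the circle common to both arcs, divided by \<open>\<tau>\<^sup>2\<close> (\<open>arc_overlap\<close>). It satisfies \<open>0 \<le> o \<le> 1 / \<tau>\<close>, and its mean
  over one uniform phase is at most \<open>1\<close>. Hence its \<open>r\<close>-th moment is at most \<open>(1 / \<tau>) ^ (r - 1)\<close> for
  \<open>r \<ge> 1\<close> (\<open>arc_overlap_moment_le\<close>): the randomness of the phase saves one factor \<open>1 / \<tau>\<close>. In
  particular pairs of sets with at most one common element add nothing to \<open>E L\<^sup>2 - 1\<close>.

  Two random \<open>K\<close>-sets share \<open>r\<close> elements with probability at most \<open>(K\<^sup>2 / N) ^ r / r!\<close>
  (\<open>overlap_probability_le\<close>). Altogether
  \<open>E L\<^sup>2 - 1 \<le> \<tau> * (\<Sum>r = 2..K. (K\<^sup>2 / (N \<tau>)) ^ r / r!)\<close>, which is \<open>chi_square_bound\<close>.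
  For fixed \<open>K\<close> the sum is finite, and its term of index \<open>r\<close> is of order
  \<open>(\<tau> N powr (r / (r - 1))) powr (1 - r)\<close>. The condition for it to vanish is strongest at \<open>r = K\<close>,
  which is the assumption on \<open>\<tau>\<close>. For \<open>K\<close> of order \<open>N powr \<alpha>\<close> the bound is at most
  \<open>\<tau> exp (K\<^sup>2 / (N \<tau>))\<close>; the choice of \<open>\<tau>\<close> makes the exponential equal to \<open>N powr \<epsilon>\<close>, and \<open>\<tau> N powr \<epsilon>\<close> is of order
  \<open>N powr (2\<alpha> - 1 + \<epsilon>) / ln N\<close>, which vanishes because \<open>\<epsilon> < 1 - 2\<alpha>\<close>.
\<close>

section \<open>The second moment bound for mixtures\<close>

lemma bounded_Fubini:
  fixes f :: "'a \<Rightarrow> 'b \<Rightarrow> real"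
  assumes "prob_space M" "prob_space Q"
    and [measurable]: "case_prod f \<in> borel_measurable (M \<Otimes>\<^sub>M Q)"
    and bound: "\<And>\<theta> x. \<theta> \<in> space M \<Longrightarrow> x \<in> space Q \<Longrightarrow> \<bar>f \<theta> x\<bar> \<le> B"
  shows "(\<integral>x. \<integral>\<theta>. f \<theta> x \<partial>M \<partial>Q) = (\<integral>\<theta>. \<integral>x. f \<theta> x \<partial>Q \<partial>M)"
proof -
  interpret M: prob_space M by fact
  interpret Q: prob_space Q by fact
  interpret MQ: pair_prob_space M Q ..
  have "integrable (M \<Otimes>\<^sub>M Q) (case_prod f)"
    by (rule MQ.integrable_const_bound[where B = B])
       (auto simp: space_pair_measure intro!: AE_I2 bound)
  then show ?thesis by (rule MQ.Fubini_integral)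
qed

text \<open>
  Cauchy--Schwarz for a likelihood ratio \<open>L\<close>: the bias of the event is the mean of \<open>L - 1\<close> on it.
\<close>

lemma (in prob_space) event_bias_le_chi_square:
  fixes L :: "'a \<Rightarrow> real"
  assumes [measurable]: "L \<in> borel_measurable M" "A \<in> sets M"
    and bound: "\<And>x. x \<in> space M \<Longrightarrow> \<bar>L x\<bar> \<le> B"
    and mean: "expectation L = 1"
  shows "(expectation (\<lambda>x. L x * indicator A x) - prob A)\<^sup>2 \<le> expectation (\<lambda>x. (L x)\<^sup>2) - 1"
proof -
  let ?X = "\<lambda>x. (L x - 1) * indicator A x"
  have L: "integrable M L"
    by (rule integrable_const_bound[where B = B]) (auto intro!: AE_I2 bound)
  have L2: "integrable M (\<lambda>x. (L x)\<^sup>2)"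
    by (rule integrable_const_bound[where B = "B\<^sup>2"])
       (auto intro!: AE_I2 abs_le_square_iff[THEN iffD1] order_trans[OF bound])
  have LA: "integrable M (\<lambda>x. L x * indicator A x)"
    using L by (rule integrable_real_mult_indicator[rotated]) simp
  have sq: "integrable M (\<lambda>x. (L x - 1)\<^sup>2)"
    unfolding power2_diff using L L2 by auto
  have X: "integrable M ?X"
    using L by (intro integrable_real_mult_indicator) auto
  have X2: "integrable M (\<lambda>x. (?X x)\<^sup>2)"
    using integrable_real_mult_indicator[OF _ sq, of A]
    by (rule Bochner_Integration.integrable_cong[THEN iffD1, rotated 2])
       (auto simp: indicator_def)
  have "integrable M (indicator A :: 'a \<Rightarrow> real)"
    by (simp add: emeasure_eq_measure)
  then have "expectation ?X = expectation (\<lambda>x. L x * indicator A x) - prob A"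
    using LA by (simp add: left_diff_distrib)
  moreover have "(expectation ?X)\<^sup>2 \<le> expectation (\<lambda>x. (?X x)\<^sup>2)"
    using variance_eq[OF X X2] variance_positive[of ?X] by linarith
  moreover have "expectation (\<lambda>x. (?X x)\<^sup>2) \<le> expectation (\<lambda>x. (L x - 1)\<^sup>2)"
    by (rule integral_mono[OF X2 sq]) (auto simp: indicator_def)
  moreover have "expectation (\<lambda>x. (L x - 1)\<^sup>2) = expectation (\<lambda>x. (L x)\<^sup>2) - 1"
    unfolding power2_diff using L L2 mean by (simp add: prob_space)
  ultimately show ?thesis by simp
qed

text \<open>
  The same bound when \<open>L\<close> averages the ratios \<open>l S \<theta>\<close> over \<open>S\<close> uniform on \<open>F\<close> and \<open>\<theta>\<close> drawn from \<open>M\<close>.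
  The second moment of \<open>L\<close> becomes a mean over two independent copies of the latent pair, with the
  data integrated first; this is the form that can be computed. The discrete part of the latent
  variable is kept as a finite sum, so that no \<open>\<sigma>\<close>-algebra on the indices is needed.
\<close>

lemma mixture_bias_le_chi_square:
  fixes l :: "'s \<Rightarrow> 'a \<Rightarrow> 'b \<Rightarrow> real"
  assumes "prob_space M" "prob_space Q" and F: "finite F" "F \<noteq> {}" and [measurable]: "A \<in> sets Q"
    and meas: "\<And>S. S \<in> F \<Longrightarrow> case_prod (l S) \<in> borel_measurable (M \<Otimes>\<^sub>M Q)"
    and bound: "\<And>S \<theta> x. S \<in> F \<Longrightarrow> \<theta> \<in> space M \<Longrightarrow> x \<in> space Q \<Longrightarrow> \<bar>l S \<theta> x\<bar> \<le> B"
    and mean: "\<And>S \<theta>. S \<in> F \<Longrightarrow> \<theta> \<in> space M \<Longrightarrow> (\<integral>x. l S \<theta> x \<partial>Q) = 1"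
  shows "((\<Sum>S\<in>F. \<integral>\<theta>. \<integral>x. l S \<theta> x * indicator A x \<partial>Q \<partial>M) / card F - measure Q A)\<^sup>2
    \<le> (\<Sum>S\<in>F. \<Sum>S'\<in>F. \<integral>\<theta>. \<integral>\<theta>'. \<integral>x. l S \<theta> x * l S' \<theta>' x \<partial>Q \<partial>M \<partial>M) / (card F)\<^sup>2 - 1"
proof -
  interpret M: prob_space M by fact
  interpret Q: prob_space Q by fact
  define m where "m S x = (\<integral>\<theta>. l S \<theta> x \<partial>M)" for S x
  define L where "L x = (\<Sum>S\<in>F. m S x) / card F" for x
  have c: "card F > 0" using F by (simp add: card_gt_0_iff)
  obtain \<theta>0 x0 where "\<theta>0 \<in> space M" "x0 \<in> space Q" using M.not_empty Q.not_empty by blast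
  then have B: "B \<ge> 0" using F bound[of _ \<theta>0 x0] by force
  have meas'[measurable]: "(\<lambda>p. l S (fst p) (snd p)) \<in> borel_measurable (M \<Otimes>\<^sub>M Q)" if "S \<in> F" for S
    using meas[OF that] by (simp add: case_prod_beta')
  have meas_swap[measurable]: "(\<lambda>p. l S (snd p) (fst p)) \<in> borel_measurable (Q \<Otimes>\<^sub>M M)" if "S \<in> F" for S
    using measurable_compose[OF measurable_pair_swap' meas'[OF that]] by (simp add: case_prod_beta')
  have meas_x: "(\<lambda>x. l S \<theta> x) \<in> borel_measurable Q" if "S \<in> F" "\<theta> \<in> space M" for S \<theta>
    using measurable_compose[OF measurable_Pair1'[OF that(2)] meas[OF that(1)]] by simp
  have meas_\<theta>: "(\<lambda>\<theta>. l S \<theta> x) \<in> borel_measurable M" if "S \<in> F" "x \<in> space Q" for S x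
    using measurable_compose[OF measurable_Pair2'[OF that(2)] meas[OF that(1)]] by simp
  have m_meas[measurable]: "m S \<in> borel_measurable Q" if [measurable]: "S \<in> F" for S
    unfolding m_def using that by measurable
  have int_\<theta>: "integrable M (\<lambda>\<theta>. l S \<theta> x)" if "S \<in> F" "x \<in> space Q" for S x
    by (rule M.integrable_const_bound[where B = B]) (auto intro!: AE_I2 bound meas_\<theta> that)
  have m_bound: "\<bar>m S x\<bar> \<le> B" if "S \<in> F" "x \<in> space Q" for S x
  proof -
    have "\<bar>m S x\<bar> \<le> (\<integral>\<theta>. \<bar>l S \<theta> x\<bar> \<partial>M)" unfolding m_def by (rule integral_abs_bound)
    also have "\<dots> \<le> (\<integral>\<theta>. B \<partial>M)"
      by (rule integral_mono) (auto intro!: integrable_abs int_\<theta> bound that)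
    finally show ?thesis by (simp add: M.prob_space)
  qed
  \<comment> \<open>Used with \<open>g\<close> the indicator of \<open>A\<close>, with \<open>g = m S'\<close> and with \<open>g = l S \<theta>\<close>; the last two
     unfold \<open>\<integral>x. m S x * m S' x\<close> one phase at a time.\<close>
  have swap: "(\<integral>x. m S x * g x \<partial>Q) = (\<integral>\<theta>. \<integral>x. l S \<theta> x * g x \<partial>Q \<partial>M)"
    if S: "S \<in> F" and [measurable]: "g \<in> borel_measurable Q"
      and g: "\<And>x. x \<in> space Q \<Longrightarrow> \<bar>g x\<bar> \<le> C" for S g C
  proof -
    note [measurable] = meas'[OF S]
    have "(\<integral>x. m S x * g x \<partial>Q) = (\<integral>x. \<integral>\<theta>. l S \<theta> x * g x \<partial>M \<partial>Q)"
      unfolding m_def by simp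
    also have "\<dots> = (\<integral>\<theta>. \<integral>x. l S \<theta> x * g x \<partial>Q \<partial>M)"
      by (rule bounded_Fubini[where B = "B * C"])
         (auto simp: abs_mult case_prod_beta' intro!: mult_mono bound g S B \<open>prob_space M\<close> \<open>prob_space Q\<close>)
    finally show ?thesis .
  qed
  have int_mg: "integrable Q (\<lambda>x. m S x * g x)"
    if S: "S \<in> F" and [measurable]: "g \<in> borel_measurable Q"
      and g: "\<And>x. x \<in> space Q \<Longrightarrow> \<bar>g x\<bar> \<le> C" for S g C
    by (rule Q.integrable_const_bound[where B = "B * C"])
       (use S in \<open>auto simp: abs_mult intro!: AE_I2 mult_mono m_bound g B\<close>)
  have L_meas: "L \<in> borel_measurable Q" unfolding L_def by measurable
  have L_bound: "\<bar>L x\<bar> \<le> B" if "x \<in> space Q" for x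
  proof -
    have "\<bar>\<Sum>S\<in>F. m S x\<bar> \<le> card F * B"
      by (rule order_trans[OF sum_abs sum_bounded_above]) (rule m_bound[OF _ that])
    then show ?thesis using c by (simp add: L_def field_simps)
  qed
  have L_mean: "Q.expectation L = 1"
  proof -
    have "(\<integral>x. m S x \<partial>Q) = 1" if "S \<in> F" for S
    proof -
      have "(\<integral>x. m S x \<partial>Q) = (\<integral>\<theta>. \<integral>x. l S \<theta> x \<partial>Q \<partial>M)"
        using swap[OF that, of "\<lambda>_. 1" 1] by simp
      also have "\<dots> = (\<integral>\<theta>. 1 \<partial>M)" by (rule Bochner_Integration.integral_cong) (auto simp: mean that)
      finally show ?thesis by (simp add: M.prob_space)
    qed
    moreover have "integrable Q (m S)" if "S \<in> F" for S
      using int_mg[OF that, of "\<lambda>_. 1" 1] by simp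
    ultimately show ?thesis unfolding L_def using c by simp
  qed
  have LA: "Q.expectation (\<lambda>x. L x * indicator A x)
      = (\<Sum>S\<in>F. \<integral>\<theta>. \<integral>x. l S \<theta> x * indicator A x \<partial>Q \<partial>M) / card F"
  proof -
    have "Q.expectation (\<lambda>x. L x * indicator A x)
        = Q.expectation (\<lambda>x. (\<Sum>S\<in>F. m S x * indicator A x) / card F)"
      by (simp add: L_def sum_distrib_right)
    also have "\<dots> = (\<Sum>S\<in>F. \<integral>x. m S x * indicator A x \<partial>Q) / card F"
      using int_mg[of _ "indicator A" 1] by (simp add: indicator_def)
    also have "\<dots> = (\<Sum>S\<in>F. \<integral>\<theta>. \<integral>x. l S \<theta> x * indicator A x \<partial>Q \<partial>M) / card F"
      using swap[of _ "indicator A" 1] by (simp add: indicator_def)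
    finally show ?thesis .
  qed
  have L2: "Q.expectation (\<lambda>x. (L x)\<^sup>2)
      = (\<Sum>S\<in>F. \<Sum>S'\<in>F. \<integral>\<theta>. \<integral>\<theta>'. \<integral>x. l S \<theta> x * l S' \<theta>' x \<partial>Q \<partial>M \<partial>M) / (card F)\<^sup>2"
  proof -
    have "Q.expectation (\<lambda>x. (L x)\<^sup>2) = Q.expectation (\<lambda>x. (\<Sum>S\<in>F. \<Sum>S'\<in>F. m S x * m S' x) / (card F)\<^sup>2)"
      by (simp add: L_def power2_eq_square sum_product)
    also have "\<dots> = (\<Sum>S\<in>F. \<Sum>S'\<in>F. \<integral>x. m S x * m S' x \<partial>Q) / (card F)\<^sup>2"
      using int_mg[OF _ m_meas m_bound] by simp
    also have "\<dots> = (\<Sum>S\<in>F. \<Sum>S'\<in>F. \<integral>\<theta>. \<integral>\<theta>'. \<integral>x. l S \<theta> x * l S' \<theta>' x \<partial>Q \<partial>M \<partial>M) / (card F)\<^sup>2"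
    proof (intro arg_cong2[where f = "(/)"] sum.cong refl)
      fix S S' assume S: "S \<in> F" "S' \<in> F"
      have "(\<integral>x. m S x * m S' x \<partial>Q) = (\<integral>\<theta>. \<integral>x. m S' x * l S \<theta> x \<partial>Q \<partial>M)"
        using swap[OF S(1) m_meas m_bound, OF S(2) S(2)] by (simp add: mult.commute)
      also have "\<dots> = (\<integral>\<theta>. \<integral>\<theta>'. \<integral>x. l S \<theta> x * l S' \<theta>' x \<partial>Q \<partial>M \<partial>M)"
      proof (rule Bochner_Integration.integral_cong)
        fix \<theta> assume \<theta>: "\<theta> \<in> space M"
        show "(\<integral>x. m S' x * l S \<theta> x \<partial>Q) = (\<integral>\<theta>'. \<integral>x. l S \<theta> x * l S' \<theta>' x \<partial>Q \<partial>M)"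
          using swap[OF S(2) meas_x[OF S(1) \<theta>] bound[OF S(1) \<theta>]] by (simp add: mult.commute)
      qed simp
      finally show "(\<integral>x. m S x * m S' x \<partial>Q) = (\<integral>\<theta>. \<integral>\<theta>'. \<integral>x. l S \<theta> x * l S' \<theta>' x \<partial>Q \<partial>M \<partial>M)" .
    qed
    finally show ?thesis .
  qed
  show ?thesis
    using Q.event_bias_le_chi_square[OF L_meas \<open>A \<in> sets Q\<close> L_bound L_mean] unfolding LA L2 .
qed

section \<open>Likelihood ratios of planted arcs\<close>

abbreviation circ_unif :: "real measure" where
  "circ_unif \<equiv> uniform_measure circle {0..<2 * pi}"

definition arc_density :: "real \<Rightarrow> bool \<Rightarrow> real \<Rightarrow> real \<Rightarrow> real" where
  "arc_density \<tau> b \<theta> y = (if b then indicator (circ_arc \<theta> \<tau>) y / \<tau> else 1)"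

definition arcs_lr :: "nat \<Rightarrow> real \<Rightarrow> nat set \<Rightarrow> real \<Rightarrow> (nat \<Rightarrow> real) \<Rightarrow> real" where
  "arcs_lr N \<tau> S \<theta> x = (\<Prod>i\<in>{1..N}. arc_density \<tau> (i \<in> S) \<theta> (x i))"

lemma id_borel_measurable_circle [measurable]: "(\<lambda>x. x) \<in> borel_measurable circle"
  unfolding circle_def by (rule measurable_restrict_space1) simp

lemma sets_hc_null [measurable_cong]: "sets (hc_null N) = sets (\<Pi>\<^sub>M i\<in>{1..N}. circle)"
  unfolding hc_null_def by (intro sets_PiM_cong) auto

lemma arc_density_nonneg: "0 < \<tau> \<Longrightarrow> 0 \<le> arc_density \<tau> b \<theta> y"
  by (simp add: arc_density_def)

lemma arc_density_le: "0 < \<tau> \<Longrightarrow> \<tau> < 1 \<Longrightarrow> arc_density \<tau> b \<theta> y \<le> 1 / \<tau>"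
  by (simp add: arc_density_def indicator_def)

text \<open>
  Joint measurability in the phase and the observation is what allows the order of integration to be
  exchanged. It is read off from the description of the arc by inequalities.
\<close>

lemma arc_density_joint_measurable:
  assumes \<tau>: "0 < \<tau>" "\<tau> < 1"
  shows "(\<lambda>p. arc_density \<tau> b (fst p) (snd p)) \<in> borel_measurable (circle \<Otimes>\<^sub>M circle)"
proof -
  let ?f = "\<lambda>p :: real \<times> real. if b then (if (fst p \<le> snd p \<and> snd p \<le> fst p + 2 * pi * \<tau>) \<or>
    snd p \<le> fst p + 2 * pi * \<tau> - 2 * pi then 1 / \<tau> else 0) else 1"
  have id: "(\<lambda>p. fst p) \<in> borel_measurable (circle \<Otimes>\<^sub>M circle)"
    "(\<lambda>p. snd p) \<in> borel_measurable (circle \<Otimes>\<^sub>M circle)"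
    using measurable_compose[OF measurable_fst id_borel_measurable_circle]
      measurable_compose[OF measurable_snd id_borel_measurable_circle] by auto
  have "?f \<in> borel_measurable (circle \<Otimes>\<^sub>M circle)"
    using id by measurable
  moreover have "arc_density \<tau> b (fst p) (snd p) = ?f p" if "p \<in> space (circle \<Otimes>\<^sub>M circle)" for p
    using that \<tau> by (auto simp: arc_density_def space_pair_measure circ_arc_eq indicator_def)
  ultimately show ?thesis by (subst measurable_cong) auto
qed

lemma arc_density_measurable:
  assumes "0 < \<tau>" "\<tau> < 1" "f \<in> M \<rightarrow>\<^sub>M circle" "g \<in> M \<rightarrow>\<^sub>M circle"
  shows "(\<lambda>x. arc_density \<tau> b (f x) (g x)) \<in> borel_measurable M"
  using measurable_compose[OF measurable_Pair[OF assms(3,4)] arc_density_joint_measurable[OF assms(1,2), of b]]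
  by simp

lemma arcs_lr_measurable:
  assumes \<tau>: "0 < \<tau>" "\<tau> < 1"
  shows "case_prod (arcs_lr N \<tau> S) \<in> borel_measurable (circ_unif \<Otimes>\<^sub>M hc_null N)"
  unfolding arcs_lr_def case_prod_beta'
  by (intro borel_measurable_prod arc_density_measurable \<tau>) measurable

lemma arcs_lr_bounds:
  assumes \<tau>: "0 < \<tau>" "\<tau> < 1"
  shows arcs_lr_nonneg: "0 \<le> arcs_lr N \<tau> S \<theta> x" and arcs_lr_le: "arcs_lr N \<tau> S \<theta> x \<le> (1 / \<tau>) ^ N"
proof -
  show "0 \<le> arcs_lr N \<tau> S \<theta> x"
    unfolding arcs_lr_def by (intro prod_nonneg ballI arc_density_nonneg \<tau>)
  have "arcs_lr N \<tau> S \<theta> x \<le> (\<Prod>i\<in>{1..N}. 1 / \<tau>)"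
    unfolding arcs_lr_def by (intro prod_mono conjI arc_density_nonneg arc_density_le \<tau>)
  then show "arcs_lr N \<tau> S \<theta> x \<le> (1 / \<tau>) ^ N" by simp
qed

lemma uniform_arc_eq_density:
  assumes \<theta>: "\<theta> \<in> {0..<2 * pi}" and \<tau>: "0 < \<tau>" "\<tau> < 1"
  shows "uniform_measure circle (if b then circ_arc \<theta> \<tau> else {0..<2 * pi})
    = density circ_unif (\<lambda>y. ennreal (arc_density \<tau> b \<theta> y))"
proof (cases b)
  case True
  note ar = \<theta>[unfolded atLeastLessThan_iff, THEN conjunct1] \<theta>[unfolded atLeastLessThan_iff, THEN conjunct2] \<tau>
  note [measurable] = circ_arc_sets_circle[OF ar]
  have "density circ_unif (\<lambda>y. ennreal (arc_density \<tau> b \<theta> y))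
    = density circle (\<lambda>y. indicator {0..<2 * pi} y / ennreal (2 * pi) * ennreal (indicator (circ_arc \<theta> \<tau>) y / \<tau>))"
    using True unfolding uniform_measure_def arc_density_def
    by (subst density_density_eq) auto
  also have "\<dots> = density circle (\<lambda>y. indicator (circ_arc \<theta> \<tau>) y / ennreal (2 * pi * \<tau>))"
  proof (intro density_cong AE_I2)
    fix y assume "y \<in> space circle"
    then show "indicator {0..<2 * pi} y / ennreal (2 * pi) * ennreal (indicator (circ_arc \<theta> \<tau>) y / \<tau>)
      = indicator (circ_arc \<theta> \<tau>) y / ennreal (2 * pi * \<tau>)"
      using \<tau> by (auto simp: indicator_def divide_ennreal ennreal_mult[symmetric] simp flip: ennreal_1)
  qed measurable
  also have "\<dots> = uniform_measure circle (circ_arc \<theta> \<tau>)"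
    unfolding uniform_measure_def emeasure_circ_arc[OF ar] ..
  finally show ?thesis using True by simp
next
  case False
  then show ?thesis by (simp add: arc_density_def density_1)
qed

lemma arc_density_mean:
  assumes \<theta>: "\<theta> \<in> {0..<2 * pi}" and \<tau>: "0 < \<tau>" "\<tau> < 1"
  shows "(\<integral>y. arc_density \<tau> b \<theta> y \<partial>circ_unif) = 1"
proof -
  have p: "prob_space (uniform_measure circle (if b then circ_arc \<theta> \<tau> else {0..<2 * pi}))"
    using \<theta> \<tau> prob_space_uniform_circle prob_space_uniform_circ_arc by simp
  have m: "(\<lambda>y. arc_density \<tau> b \<theta> y) \<in> borel_measurable circ_unif"
    by (rule arc_density_measurable) (use \<theta> \<tau> in auto)
  have "(\<integral>\<^sup>+y. ennreal (arc_density \<tau> b \<theta> y) \<partial>circ_unif)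
      = (\<integral>\<^sup>+y. ennreal (arc_density \<tau> b \<theta> y) * indicator (space circ_unif) y \<partial>circ_unif)"
    by (rule nn_integral_cong) (simp only: indicator_simps mult_1_right)
  also have "\<dots> = emeasure (density circ_unif (\<lambda>y. ennreal (arc_density \<tau> b \<theta> y))) (space circ_unif)"
    using m by (intro emeasure_density[symmetric]) auto
  also have "\<dots> = 1"
    using prob_space.emeasure_space_1[OF p] unfolding uniform_arc_eq_density[OF \<theta> \<tau>] by simp
  finally have "(\<integral>\<^sup>+y. ennreal (arc_density \<tau> b \<theta> y) \<partial>circ_unif) = 1" .
  then show ?thesis
    using m by (subst integral_eq_nn_integral) (auto simp: arc_density_nonneg \<tau>)
qed

lemma arc_density_integrable:
  assumes \<theta>: "\<theta> \<in> {0..<2 * pi}" and \<tau>: "0 < \<tau>" "\<tau> < 1"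
  shows "integrable circ_unif (arc_density \<tau> b \<theta>)"
proof -
  interpret prob_space circ_unif by (rule prob_space_uniform_circle)
  show ?thesis
    by (rule integrable_const_bound[where B = "1 / \<tau>"])
       (use \<theta> \<tau> in \<open>auto intro!: arc_density_measurable arc_density_le simp: arc_density_nonneg\<close>)
qed

lemma arc_density_prod_integrable:
  assumes \<theta>: "\<theta> \<in> {0..<2 * pi}" "\<theta>' \<in> {0..<2 * pi}" and \<tau>: "0 < \<tau>" "\<tau> < 1"
  shows "integrable circ_unif (\<lambda>y. arc_density \<tau> b \<theta> y * arc_density \<tau> b' \<theta>' y)"
proof -
  interpret prob_space circ_unif by (rule prob_space_uniform_circle)
  have "(\<lambda>y. arc_density \<tau> b \<theta> y * arc_density \<tau> b' \<theta>' y) \<in> borel_measurable circ_unif"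
    by (intro borel_measurable_times arc_density_measurable) (use \<theta> \<tau> in auto)
  then show ?thesis
    by (rule integrable_const_bound[rotated, where B = "1 / \<tau> * (1 / \<tau>)"])
       (use \<tau> in \<open>auto intro!: AE_I2 mult_mono arc_density_le simp: arc_density_nonneg abs_mult
         simp del: times_divide_eq_left times_divide_eq_right\<close>)
qed

text \<open>
  A product of densities is the density of the product measure; both sides are compared on boxes.
\<close>

lemma hc_cond_eq_density:
  assumes \<theta>: "\<theta> \<in> {0..<2 * pi}" and \<tau>: "0 < \<tau>" "\<tau> < 1"
  shows "hc_cond N \<tau> S \<theta> = density (hc_null N) (\<lambda>x. ennreal (arcs_lr N \<tau> S \<theta> x))"
proof -
  let ?U = "\<lambda>i. uniform_measure circle (if i \<in> S then circ_arc \<theta> \<tau> else {0..<2 * pi})"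
  interpret U: product_prob_space ?U
    by (intro product_prob_spaceI)
       (use \<theta> \<tau> in \<open>auto intro: prob_space_uniform_circle prob_space_uniform_circ_arc\<close>)
  interpret C: product_prob_space "\<lambda>_. circ_unif"
    by (intro product_prob_spaceI prob_space_uniform_circle)
  have dm[measurable]: "arc_density \<tau> b \<theta> \<in> borel_measurable circle" for b
    by (rule arc_density_measurable) (use \<theta> \<tau> in auto)
  have "density (hc_null N) (\<lambda>x. ennreal (arcs_lr N \<tau> S \<theta> x)) = PiM {1..N} ?U"
  proof (rule U.PiM_eqI)
    show "sets (density (hc_null N) (\<lambda>x. ennreal (arcs_lr N \<tau> S \<theta> x))) = sets (PiM {1..N} ?U)"
      by (simp add: sets_hc_null) (intro sets_PiM_cong; simp)
  next
    fix A assume A: "\<And>i. i \<in> {1..N} \<Longrightarrow> A i \<in> sets (?U i)"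
    then have A': "\<And>i. i \<in> {1..N} \<Longrightarrow> A i \<in> sets circle" by auto
    have lr_meas: "arcs_lr N \<tau> S \<theta> \<in> borel_measurable (hc_null N)"
      unfolding arcs_lr_def by measurable
    have AE: "Pi\<^sub>E {1..N} A \<in> sets (hc_null N)"
      unfolding sets_hc_null using A' by (intro sets_PiM_I_finite) auto
    have "emeasure (density (hc_null N) (\<lambda>x. ennreal (arcs_lr N \<tau> S \<theta> x))) (Pi\<^sub>E {1..N} A)
        = (\<integral>\<^sup>+x. ennreal (arcs_lr N \<tau> S \<theta> x) * indicator (Pi\<^sub>E {1..N} A) x \<partial>hc_null N)"
      using lr_meas AE by (intro emeasure_density) auto
    also have "\<dots> = (\<integral>\<^sup>+x. (\<Prod>i\<in>{1..N}. ennreal (arc_density \<tau> (i \<in> S) \<theta> (x i)) * indicator (A i) (x i)) \<partial>hc_null N)"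
    proof (rule nn_integral_cong)
      fix x assume "x \<in> space (hc_null N)"
      then have "indicator (Pi\<^sub>E {1..N} A) x = (\<Prod>i\<in>{1..N}. indicator (A i) (x i) :: ennreal)"
        by (auto simp: indicator_def hc_null_def space_PiM PiE_iff)
      then show "ennreal (arcs_lr N \<tau> S \<theta> x) * indicator (Pi\<^sub>E {1..N} A) x
        = (\<Prod>i\<in>{1..N}. ennreal (arc_density \<tau> (i \<in> S) \<theta> (x i)) * indicator (A i) (x i))"
        by (simp add: arcs_lr_def prod.distrib prod_ennreal arc_density_nonneg \<tau>)
    qed
    also have "\<dots> = (\<Prod>i\<in>{1..N}. \<integral>\<^sup>+y. ennreal (arc_density \<tau> (i \<in> S) \<theta> y) * indicator (A i) y \<partial>circ_unif)"
      unfolding hc_null_def by (rule C.product_nn_integral_prod) (use A' in auto)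
    also have "\<dots> = (\<Prod>i\<in>{1..N}. emeasure (?U i) (A i))"
      unfolding uniform_arc_eq_density[OF \<theta> \<tau>]
      by (intro prod.cong refl, subst emeasure_density) (use A' in auto)
    finally show "emeasure (density (hc_null N) (\<lambda>x. ennreal (arcs_lr N \<tau> S \<theta> x))) (Pi\<^sub>E {1..N} A)
      = (\<Prod>i\<in>{1..N}. emeasure (?U i) (A i))" .
  qed simp
  then show ?thesis unfolding hc_cond_def ..
qed

lemma arcs_lr_mean:
  assumes \<theta>: "\<theta> \<in> {0..<2 * pi}" and \<tau>: "0 < \<tau>" "\<tau> < 1"
  shows "(\<integral>x. arcs_lr N \<tau> S \<theta> x \<partial>hc_null N) = 1"
proof -
  interpret product_prob_space "\<lambda>_::nat. circ_unif"
    by (intro product_prob_spaceI prob_space_uniform_circle)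
  show ?thesis
    unfolding arcs_lr_def hc_null_def
    by (subst product_integral_prod)
       (simp_all add: arc_density_mean[OF assms] arc_density_integrable[OF assms])
qed

text \<open>
  With \<open>\<mu>\<close> the uniform probability on the circle, this is \<open>\<mu> (arc \<theta> \<inter> arc \<theta>') / \<tau>\<^sup>2\<close>. The form as
  a correlation of densities is the one in which it arises, and it gives the bound \<open>1 / \<tau>\<close> and the
  mean over a phase without computing the length of an intersection of arcs.
\<close>

definition arc_overlap :: "real \<Rightarrow> real \<Rightarrow> real \<Rightarrow> real" where
  "arc_overlap \<tau> \<theta> \<theta>' = (\<integral>y. arc_density \<tau> True \<theta> y * arc_density \<tau> True \<theta>' y \<partial>circ_unif)"

text \<open>
  The integral factorises over the coordinates. A coordinate in just one of the two sets contributes the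
  total mass \<open>1\<close> of an arc density, so only \<open>S \<inter> S'\<close> matters.
\<close>

lemma arcs_lr_correlation:
  assumes \<theta>: "\<theta> \<in> {0..<2 * pi}" "\<theta>' \<in> {0..<2 * pi}" and \<tau>: "0 < \<tau>" "\<tau> < 1"
    and S: "S \<subseteq> {1..N}"
  shows "(\<integral>x. arcs_lr N \<tau> S \<theta> x * arcs_lr N \<tau> S' \<theta>' x \<partial>hc_null N) = arc_overlap \<tau> \<theta> \<theta>' ^ card (S \<inter> S')"
proof -
  interpret C: prob_space circ_unif by (rule prob_space_uniform_circle)
  interpret product_prob_space "\<lambda>_::nat. circ_unif"
    by (intro product_prob_spaceI prob_space_uniform_circle)
  have "(\<integral>x. arcs_lr N \<tau> S \<theta> x * arcs_lr N \<tau> S' \<theta>' x \<partial>hc_null N)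
    = (\<Prod>i\<in>{1..N}. \<integral>y. arc_density \<tau> (i \<in> S) \<theta> y * arc_density \<tau> (i \<in> S') \<theta>' y \<partial>circ_unif)"
    unfolding arcs_lr_def hc_null_def prod.distrib[symmetric]
    by (rule product_integral_prod) (auto intro: arc_density_prod_integrable assms)
  also have "\<dots> = (\<Prod>i\<in>{1..N}. if i \<in> S \<inter> S' then arc_overlap \<tau> \<theta> \<theta>' else 1)"
  proof (rule prod.cong[OF refl])
    fix i
    have one: "arc_density \<tau> False \<theta> = (\<lambda>_. 1)" for \<theta>
      by (simp add: arc_density_def fun_eq_iff)
    show "(\<integral>y. arc_density \<tau> (i \<in> S) \<theta> y * arc_density \<tau> (i \<in> S') \<theta>' y \<partial>circ_unif)
      = (if i \<in> S \<inter> S' then arc_overlap \<tau> \<theta> \<theta>' else 1)"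
      by (cases "i \<in> S"; cases "i \<in> S'")
         (simp_all add: one arc_overlap_def arc_density_mean[OF \<theta>(1) \<tau>] arc_density_mean[OF \<theta>(2) \<tau>]
           C.prob_space[simplified])
  qed
  also have "\<dots> = arc_overlap \<tau> \<theta> \<theta>' ^ card (S \<inter> S')"
  proof -
    have "{1..N} \<inter> {i. i \<in> S \<inter> S'} = S \<inter> S'" using S by blast
    then show ?thesis by (subst prod.If_cases) auto
  qed
  finally show ?thesis .
qed

text \<open>
  The phases whose arc covers a given point \<open>y\<close> form an arc of the same length that ends at \<open>y\<close>.
\<close>

lemma arc_density_phase_mean_le:
  assumes y: "y \<in> {0..<2 * pi}" and \<tau>: "0 < \<tau>" "\<tau> < 1"
  shows "(\<integral>\<theta>. arc_density \<tau> True \<theta> y \<partial>circ_unif) \<le> 1"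
proof -
  interpret C: prob_space circ_unif by (rule prob_space_uniform_circle)
  define w where "w = 2 * pi * \<tau>"
  \<comment> \<open>The arc of phases \<open>[y - w, y]\<close>, cut at \<open>0\<close> if it wraps around.\<close>
  define T where "T = (if w \<le> y then {y - w..y} else {0..y} \<union> {y + 2 * pi - w..<2 * pi})"
  have w: "0 < w" "w < 2 * pi" using \<tau> by (auto simp: w_def)
  have T: "T \<subseteq> {0..<2 * pi}" using y w by (auto simp: T_def)
  have Tc: "T \<in> sets circle"
    using T unfolding circle_def by (subst sets_restrict_space_iff) (auto simp: T_def)
  have "emeasure lborel T \<le> ennreal w"
  proof (cases "w \<le> y")
    case True
    then show ?thesis using w by (simp add: T_def)
  next
    case False
    have "emeasure lborel T \<le> emeasure lborel {0..y} + emeasure lborel {y + 2 * pi - w..<2 * pi}"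
      unfolding T_def if_not_P[OF False] by (rule emeasure_subadditive) auto
    also have "\<dots> = ennreal w"
      using False y by (simp add: ennreal_plus[symmetric] del: ennreal_plus)
    finally show ?thesis .
  qed
  then have le: "emeasure circle T \<le> ennreal w"
    using T by (subst emeasure_circle) (auto simp: T_def)
  have "emeasure circ_unif T \<le> ennreal \<tau>"
  proof -
    have "{0..<2 * pi} \<inter> T = T" using T by blast
    then have "emeasure circ_unif T = emeasure circle T / ennreal (2 * pi)"
      using Tc by (subst emeasure_uniform_measure) auto
    also have "\<dots> \<le> ennreal w / ennreal (2 * pi)" by (intro divide_right_mono_ennreal le)
    also have "\<dots> = ennreal \<tau>" using \<tau> by (simp add: divide_ennreal w_def)
    finally show ?thesis .
  qed
  then have mT: "measure circ_unif T \<le> \<tau>"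
    using \<tau> by (simp add: C.emeasure_eq_measure)
  have "(\<integral>\<theta>. arc_density \<tau> True \<theta> y \<partial>circ_unif) \<le> (\<integral>\<theta>. indicator T \<theta> / \<tau> \<partial>circ_unif)"
  proof (rule integral_mono')
    show "integrable circ_unif (\<lambda>\<theta>. indicator T \<theta> / \<tau>)"
      using Tc by (intro integrable_divide integrable_real_indicator) (auto simp: C.emeasure_eq_measure)
    fix \<theta> assume "\<theta> \<in> space circ_unif"
    then have \<theta>: "0 \<le> \<theta>" "\<theta> < 2 * pi" by auto
    have "\<theta> \<in> T" if "y \<in> circ_arc \<theta> \<tau>"
      using that \<theta> y w unfolding circ_arc_eq[OF \<theta> \<tau>] w_def[symmetric] T_def by auto
    then show "arc_density \<tau> True \<theta> y \<le> indicator T \<theta> / \<tau>"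
      using \<tau> by (simp add: arc_density_def indicator_def)
  qed (use \<tau> in auto)
  also have "\<dots> = measure circ_unif T / \<tau>" using T by (simp add: Int_absorb2 del: measure_uniform_measure)
  also have "\<dots> \<le> 1" using mT \<tau> by simp
  finally show ?thesis .
qed

lemma arc_overlap_bounds:
  assumes \<theta>: "\<theta> \<in> {0..<2 * pi}" "\<theta>' \<in> {0..<2 * pi}" and \<tau>: "0 < \<tau>" "\<tau> < 1"
  shows arc_overlap_nonneg: "0 \<le> arc_overlap \<tau> \<theta> \<theta>'" and arc_overlap_le: "arc_overlap \<tau> \<theta> \<theta>' \<le> 1 / \<tau>"
proof -
  show "0 \<le> arc_overlap \<tau> \<theta> \<theta>'"
    unfolding arc_overlap_def by (intro integral_nonneg_AE AE_I2 mult_nonneg_nonneg arc_density_nonneg \<tau>)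
  have "arc_overlap \<tau> \<theta> \<theta>' \<le> (\<integral>y. 1 / \<tau> * arc_density \<tau> True \<theta>' y \<partial>circ_unif)"
    unfolding arc_overlap_def
    by (intro integral_mono arc_density_prod_integrable integrable_mult_right arc_density_integrable
        mult_right_mono arc_density_le arc_density_nonneg assms)
  also have "\<dots> = 1 / \<tau>" by (simp only: integral_mult_right_zero arc_density_mean[OF \<theta>(2) \<tau>] mult_1_right)
  finally show "arc_overlap \<tau> \<theta> \<theta>' \<le> 1 / \<tau>" .
qed

lemma arc_overlap_measurable:
  assumes \<theta>: "\<theta> \<in> {0..<2 * pi}" and \<tau>: "0 < \<tau>" "\<tau> < 1"
  shows "arc_overlap \<tau> \<theta> \<in> borel_measurable circ_unif"
proof -
  interpret prob_space circ_unif by (rule prob_space_uniform_circle)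
  show ?thesis
    unfolding arc_overlap_def
    by (rule borel_measurable_lebesgue_integral)
       (use \<theta> \<tau> in \<open>auto simp: case_prod_beta' intro!: borel_measurable_times arc_density_measurable\<close>)
qed

lemma arc_overlap_phase_mean_le:
  assumes \<theta>: "\<theta> \<in> {0..<2 * pi}" and \<tau>: "0 < \<tau>" "\<tau> < 1"
  shows "(\<integral>\<theta>'. arc_overlap \<tau> \<theta> \<theta>' \<partial>circ_unif) \<le> 1"
proof -
  let ?d = "arc_density \<tau> True"
  have "(\<integral>\<theta>'. arc_overlap \<tau> \<theta> \<theta>' \<partial>circ_unif) = (\<integral>y. \<integral>\<theta>'. ?d \<theta> y * ?d \<theta>' y \<partial>circ_unif \<partial>circ_unif)"
    unfolding arc_overlap_def
  proof (rule bounded_Fubini[symmetric, where B = "1 / \<tau> * (1 / \<tau>)"])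
    show "(\<lambda>(\<theta>', y). ?d \<theta> y * ?d \<theta>' y) \<in> borel_measurable (circ_unif \<Otimes>\<^sub>M circ_unif)"
      unfolding case_prod_beta'
      by (intro borel_measurable_times arc_density_measurable) (use \<theta> \<tau> in auto)
  qed (use \<tau> in \<open>auto intro!: prob_space_uniform_circle mult_mono arc_density_le
        simp: arc_density_nonneg abs_mult simp del: times_divide_eq_left times_divide_eq_right\<close>)
  also have "\<dots> \<le> (\<integral>y. ?d \<theta> y \<partial>circ_unif)"
  proof (rule integral_mono'[OF arc_density_integrable[OF \<theta> \<tau>]])
    fix y assume "y \<in> space circ_unif"
    then show "(\<integral>\<theta>'. ?d \<theta> y * ?d \<theta>' y \<partial>circ_unif) \<le> ?d \<theta> y"
      using mult_left_mono[OF arc_density_phase_mean_le[of y \<tau>] arc_density_nonneg, of \<tau> True \<theta> y] \<tau> by simp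
  qed (simp add: arc_density_nonneg \<tau>)
  also have "\<dots> = 1" by (rule arc_density_mean[OF \<theta> \<tau>])
  finally show ?thesis .
qed

text \<open>
  All factors but one are bounded by \<open>1 / \<tau>\<close>, and the last one has mean at most \<open>1\<close>. The truncated
  exponent \<open>r - 1\<close> is right for \<open>r = 0\<close> as well, where both sides are \<open>1\<close>.
\<close>

lemma arc_overlap_moment_le:
  assumes \<tau>: "0 < \<tau>" "\<tau> < 1"
  shows "(\<integral>\<theta>. \<integral>\<theta>'. arc_overlap \<tau> \<theta> \<theta>' ^ r \<partial>circ_unif \<partial>circ_unif) \<le> (1 / \<tau>) ^ (r - 1)"
proof -
  interpret prob_space circ_unif by (rule prob_space_uniform_circle)
  have inner: "(\<integral>\<theta>'. arc_overlap \<tau> \<theta> \<theta>' ^ r \<partial>circ_unif) \<le> (1 / \<tau>) ^ (r - 1)"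
    if \<theta>: "\<theta> \<in> {0..<2 * pi}" for \<theta>
  proof (cases r)
    case 0
    then show ?thesis by (simp add: prob_space)
  next
    case (Suc k)
    have int: "integrable circ_unif (arc_overlap \<tau> \<theta>)"
      by (rule integrable_const_bound[where B = "1 / \<tau>"])
         (use \<theta> \<tau> in \<open>auto intro!: arc_overlap_measurable simp: arc_overlap_bounds\<close>)
    have "(\<integral>\<theta>'. arc_overlap \<tau> \<theta> \<theta>' ^ r \<partial>circ_unif)
      \<le> (\<integral>\<theta>'. (1 / \<tau>) ^ k * arc_overlap \<tau> \<theta> \<theta>' \<partial>circ_unif)"
    proof (rule integral_mono')
      show "integrable circ_unif (\<lambda>\<theta>'. (1 / \<tau>) ^ k * arc_overlap \<tau> \<theta> \<theta>')"
        by (intro integrable_mult_right int)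
      fix \<theta>' assume "\<theta>' \<in> space circ_unif"
      then have \<theta>': "\<theta>' \<in> {0..<2 * pi}" by simp
      note o = arc_overlap_nonneg[OF \<theta> \<theta>' \<tau>] arc_overlap_le[OF \<theta> \<theta>' \<tau>]
      show "arc_overlap \<tau> \<theta> \<theta>' ^ r \<le> (1 / \<tau>) ^ k * arc_overlap \<tau> \<theta> \<theta>'"
        unfolding Suc power_Suc2 by (intro mult_right_mono power_mono o)
      show "0 \<le> (1 / \<tau>) ^ k * arc_overlap \<tau> \<theta> \<theta>'"
        using o \<tau> by simp
    qed
    also have "\<dots> = (1 / \<tau>) ^ k * (\<integral>\<theta>'. arc_overlap \<tau> \<theta> \<theta>' \<partial>circ_unif)" by (rule integral_mult_right_zero)
    also have "\<dots> \<le> (1 / \<tau>) ^ k * 1"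
      using \<tau> by (intro mult_left_mono arc_overlap_phase_mean_le \<theta>) auto
    finally show ?thesis using Suc by simp
  qed
  have "(\<integral>\<theta>. \<integral>\<theta>'. arc_overlap \<tau> \<theta> \<theta>' ^ r \<partial>circ_unif \<partial>circ_unif) \<le> (\<integral>\<theta>. (1 / \<tau>) ^ (r - 1) \<partial>circ_unif)"
    by (rule integral_mono') (use inner \<tau> in auto)
  also have "\<dots> = (1 / \<tau>) ^ (r - 1)"
    unfolding lebesgue_integral_const prob_space by simp
  finally show ?thesis .
qed


section \<open>Overlaps of random subsets\<close>

text \<open>
  The probability \<open>(k choose r) / (n choose r)\<close> that \<open>r\<close> draws without replacement all hit a set of
  size \<open>k\<close> is at most \<open>(k / n) ^ r\<close>, since each factor \<open>(k - i) / (n - i)\<close> is at most \<open>k / n\<close>.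
\<close>

lemma binomial_ratio_le:
  assumes "r \<le> k" "k \<le> n"
  shows "real (k choose r) * real n ^ r \<le> real (n choose r) * real k ^ r"
proof -
  have "real (k choose r) * real n ^ r = (\<Prod>i = 0..<r. real (k - i) / real (r - i) * real n)"
    using assms by (simp only: binomial_altdef_of_nat prod.distrib prod_constant card_atLeastLessThan diff_zero)
  also have "\<dots> \<le> (\<Prod>i = 0..<r. real (n - i) / real (r - i) * real k)"
  proof (intro prod_mono conjI)
    fix i assume i: "i \<in> {0..<r}"
    then have "real (k - i) * real n \<le> real (n - i) * real k"
      using assms by (simp add: of_nat_diff algebra_simps mult_left_mono)
    then show "real (k - i) / real (r - i) * real n \<le> real (n - i) / real (r - i) * real k"
      using i by (simp add: divide_right_mono)
  qed simp
  also have "\<dots> = real (n choose r) * real k ^ r"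
    using assms by (simp only: binomial_altdef_of_nat[OF le_trans] prod.distrib prod_constant card_atLeastLessThan diff_zero)
  finally show ?thesis .
qed

text \<open>
  A union bound over the \<open>r\<close>-subset \<open>R\<close> of \<open>T\<close> that \<open>S\<close> contains: what remains of \<open>S\<close> is any
  \<open>(k - r)\<close>-subset of \<open>A - R\<close>.
\<close>

lemma card_subsets_with_overlap_le:
  assumes A: "finite A" "card A = n" and T: "T \<subseteq> A" "card T = k" and r: "r \<le> k"
  shows "card {S. S \<subseteq> A \<and> card S = k \<and> card (S \<inter> T) = r} \<le> (k choose r) * ((n - r) choose (k - r))"
proof -
  let ?R = "{R. R \<subseteq> T \<and> card R = r}"
  let ?V = "\<lambda>R. {V. V \<subseteq> A - R \<and> card V = k - r}"
  have fT: "finite T" using A T finite_subset by blast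
  have cV: "card (?V R) = (n - r) choose (k - r)" if "R \<in> ?R" for R
  proof -
    have "card (A - R) = n - r"
      using that A T fT by (subst card_Diff_subset) (auto intro: finite_subset)
    then show ?thesis using A by (subst n_subsets) auto
  qed
  have "{S. S \<subseteq> A \<and> card S = k \<and> card (S \<inter> T) = r} \<subseteq> (\<Union>R\<in>?R. (\<lambda>V. R \<union> V) ` ?V R)"
  proof
    fix S assume "S \<in> {S. S \<subseteq> A \<and> card S = k \<and> card (S \<inter> T) = r}"
    then have S: "S \<subseteq> A" "card S = k" "card (S \<inter> T) = r" by auto
    have "card (S - S \<inter> T) = k - r"
      using S fT by (subst card_Diff_subset) auto
    then have "S - S \<inter> T \<in> ?V (S \<inter> T)" using S by blast
    moreover have "S = S \<inter> T \<union> (S - S \<inter> T)" by blast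
    ultimately show "S \<in> (\<Union>R\<in>?R. (\<lambda>V. R \<union> V) ` ?V R)" using S by blast
  qed
  then have "card {S. S \<subseteq> A \<and> card S = k \<and> card (S \<inter> T) = r}
      \<le> card (\<Union>R\<in>?R. (\<lambda>V. R \<union> V) ` ?V R)"
    using A fT by (intro card_mono) (auto intro!: finite_imageI simp: finite_subset)
  also have "\<dots> \<le> (\<Sum>R\<in>?R. card ((\<lambda>V. R \<union> V) ` ?V R))"
    using fT by (intro card_UN_le) auto
  also have "\<dots> \<le> (\<Sum>R\<in>?R. (n - r) choose (k - r))"
    using A cV by (intro sum_mono order_trans[OF card_image_le]) auto
  also have "\<dots> = (k choose r) * ((n - r) choose (k - r))"
    using fT T by (simp add: n_subsets)
  finally show ?thesis .
qed

text \<open>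
  The count above, divided by \<open>n choose k\<close>, is \<open>(k choose r)\<^sup>2 / (n choose r)\<close>. One factor \<open>k choose r\<close>
  is absorbed by the denominator through \<open>binomial_ratio_le\<close>, the other is at most \<open>k ^ r / fact r\<close>.
\<close>

lemma overlap_probability_le:
  assumes A: "finite A" "card A = n" and T: "T \<subseteq> A" "card T = k" and r: "r \<le> k" and n: "0 < n"
  shows "real (card {S. S \<subseteq> A \<and> card S = k \<and> card (S \<inter> T) = r})
    \<le> real (n choose k) * ((real k)\<^sup>2 / real n) ^ r / fact r"
proof -
  have kn: "k \<le> n" using A T card_mono by metis
  have pos: "0 < real (n choose r)" using r kn by simp
  have "real (k choose r) \<le> real (n choose r) * (real k / real n) ^ r"
    using binomial_ratio_le[OF r kn] n by (simp add: power_divide pos_le_divide_eq)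
  moreover have "real (k choose r) \<le> real k ^ r / fact r"
  proof -
    have "real ((k choose r) * fact r) \<le> real (k ^ r)"
      using binomial_fact_pow by (simp only: of_nat_le_iff)
    then show ?thesis by (simp add: pos_le_divide_eq)
  qed
  ultimately have "real (k choose r) * real (k choose r)
      \<le> (real (n choose r) * (real k / real n) ^ r) * (real k ^ r / fact r)"
    by (intro mult_mono) auto
  then have sq: "real (k choose r) * real (k choose r)
      \<le> real (n choose r) * (((real k)\<^sup>2 / real n) ^ r / fact r)"
    by (simp only: power_divide power_mult_distrib power2_eq_square times_divide_eq_left times_divide_eq_right
        divide_divide_eq_left mult_ac)
  have "real (n choose r) * real ((k choose r) * ((n - r) choose (k - r)))
      = real (k choose r) * real ((n choose r) * ((n - r) choose (k - r)))" by simp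
  also have "\<dots> = real (n choose k) * (real (k choose r) * real (k choose r))"
    unfolding choose_mult[OF r kn, symmetric] by simp
  also have "\<dots> \<le> real (n choose k) * (real (n choose r) * (((real k)\<^sup>2 / real n) ^ r / fact r))"
    by (intro mult_left_mono sq) simp
  finally have "real (n choose r) * real ((k choose r) * ((n - r) choose (k - r)))
      \<le> real (n choose r) * (real (n choose k) * (((real k)\<^sup>2 / real n) ^ r / fact r))"
    by (simp only: mult_ac)
  then have "real ((k choose r) * ((n - r) choose (k - r))) \<le> real (n choose k) * (((real k)\<^sup>2 / real n) ^ r / fact r)"
    using pos by (simp only: mult_le_cancel_left_pos)
  moreover have "real (card {S. S \<subseteq> A \<and> card S = k \<and> card (S \<inter> T) = r}) \<le> real ((k choose r) * ((n - r) choose (k - r)))"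
    using card_subsets_with_overlap_le[OF A T r] by (simp only: of_nat_le_iff)
  ultimately show ?thesis by simp
qed

definition chi_square_bound :: "nat \<Rightarrow> nat \<Rightarrow> real \<Rightarrow> real" where
  "chi_square_bound N K \<tau> = \<tau> * (\<Sum>r = 2..K. ((real K)\<^sup>2 / (real N * \<tau>)) ^ r / fact r)"

lemma chi_square_bound_nonneg: "0 < \<tau> \<Longrightarrow> 0 \<le> chi_square_bound N K \<tau>"
  unfolding chi_square_bound_def by (intro mult_nonneg_nonneg sum_nonneg) auto

text \<open>
  Relative to \<open>1\<close>, a pair of sets only contributes when it overlaps in at least two elements, which is
  where the sum in \<open>chi_square_bound\<close> starts. Its prefactor \<open>\<tau>\<close> is the saved factor in
  \<open>(1 / \<tau>) ^ (r - 1) = \<tau> * (1 / \<tau>) ^ r\<close>.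
\<close>

lemma average_overlap_le:
  assumes \<tau>: "0 < \<tau>" "\<tau> < 1" and KN: "K \<le> N" "0 < N"
  defines "F \<equiv> {S. S \<subseteq> {1..N} \<and> card S = K}"
  shows "(\<Sum>S\<in>F. \<Sum>T\<in>F. (1 / \<tau>) ^ (card (S \<inter> T) - 1)) / (card F)\<^sup>2 - 1 \<le> chi_square_bound N K \<tau>"
proof -
  have F: "finite F" by (simp add: F_def)
  have cF: "card F = N choose K" unfolding F_def by (subst n_subsets) auto
  have pos: "0 < real (card F)" using KN unfolding cF by simp
  have inner: "(\<Sum>S\<in>F. (1 / \<tau>) ^ (card (S \<inter> T) - 1)) \<le> card F * (1 + chi_square_bound N K \<tau>)"
    if T: "T \<in> F" for T
  proof -
    have T': "T \<subseteq> {1..N}" "card T = K" "finite T" using T finite_subset by (auto simp: F_def)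
    have "(\<Sum>S\<in>F. (1 / \<tau>) ^ (card (S \<inter> T) - 1))
        \<le> (\<Sum>S\<in>F. 1 + (\<Sum>r = 2..K. if card (S \<inter> T) = r then (1 / \<tau>) ^ (r - 1) else 0))"
    proof (rule sum_mono)
      fix S assume "S \<in> F"
      have "card (S \<inter> T) \<le> K" using card_mono[of T "S \<inter> T"] T' by auto
      then consider "card (S \<inter> T) < 2" | "card (S \<inter> T) \<in> {2..K}" by force
      then show "(1 / \<tau>) ^ (card (S \<inter> T) - 1)
          \<le> 1 + (\<Sum>r = 2..K. if card (S \<inter> T) = r then (1 / \<tau>) ^ (r - 1) else 0)"
      proof cases
        case 1
        then have "card (S \<inter> T) - 1 = 0" by simp
        then show ?thesis using \<tau> by (auto intro!: sum_nonneg simp del: diff_is_0_eq diff_is_0_eq')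
      next
        case 2
        then show ?thesis by (subst sum.delta') auto
      qed
    qed
    also have "\<dots> = card F + (\<Sum>r = 2..K. \<Sum>S\<in>F. if card (S \<inter> T) = r then (1 / \<tau>) ^ (r - 1) else 0)"
      unfolding sum.distrib by (subst sum.swap) simp
    also have "(\<Sum>r = 2..K. \<Sum>S\<in>F. if card (S \<inter> T) = r then (1 / \<tau>) ^ (r - 1) else 0)
        \<le> (\<Sum>r = 2..K. card F * (\<tau> * (((real K)\<^sup>2 / (real N * \<tau>)) ^ r / fact r)))"
    proof (rule sum_mono)
      fix r assume r: "r \<in> {2..K}"
      have "(\<Sum>S\<in>F. if card (S \<inter> T) = r then (1 / \<tau>) ^ (r - 1) else 0)
          = card {S. S \<subseteq> {1..N} \<and> card S = K \<and> card (S \<inter> T) = r} * (1 / \<tau>) ^ (r - 1)"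
        using F by (subst sum.inter_filter[symmetric]) (auto simp: F_def conj_assoc)
      also have "\<dots> \<le> (N choose K) * ((real K)\<^sup>2 / real N) ^ r / fact r * (1 / \<tau>) ^ (r - 1)"
        using r \<tau> KN T' by (intro mult_right_mono overlap_probability_le) auto
      also have "\<dots> = (N choose K) * ((real K)\<^sup>2 / real N) ^ r / fact r * (\<tau> * (1 / \<tau>) ^ r)"
        using r \<tau> by (cases r) auto
      finally show "(\<Sum>S\<in>F. if card (S \<inter> T) = r then (1 / \<tau>) ^ (r - 1) else 0)
          \<le> card F * (\<tau> * (((real K)\<^sup>2 / (real N * \<tau>)) ^ r / fact r))"
        unfolding cF by (simp only: power_divide power_mult_distrib times_divide_eq_left times_divide_eq_right
            power_one mult_1_right divide_divide_eq_left mult_ac)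
    qed
    finally show ?thesis
      by (simp add: chi_square_bound_def sum_distrib_left distrib_left)
  qed
  have "(\<Sum>S\<in>F. \<Sum>T\<in>F. (1 / \<tau>) ^ (card (S \<inter> T) - 1)) = (\<Sum>T\<in>F. \<Sum>S\<in>F. (1 / \<tau>) ^ (card (S \<inter> T) - 1))"
    by (rule sum.swap)
  also have "\<dots> \<le> card F * (card F * (1 + chi_square_bound N K \<tau>))"
    by (rule sum_bounded_above) (rule inner)
  finally show ?thesis
    using pos by (simp add: power2_eq_square field_simps)
qed


section \<open>The error of a test\<close>

lemma measure_hc_alt:
  assumes \<tau>: "0 < \<tau>" "\<tau> < 1" and K: "K \<le> N" and A: "A \<in> sets (hc_null N)"
  defines "F \<equiv> {S. S \<subseteq> {1..N} \<and> card S = K}"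
  shows "measure (hc_alt N K \<tau>) A
    = (\<Sum>S\<in>F. \<integral>\<theta>. \<integral>x. arcs_lr N \<tau> S \<theta> x * indicator A x \<partial>hc_null N \<partial>circ_unif) / card F"
proof -
  interpret U: prob_space circ_unif by (rule prob_space_uniform_circle)
  interpret Q: prob_space "hc_null N" by (rule prob_space_hc_null)
  interpret P: prob_space "hc_alt N K \<tau>" by (rule prob_space_hc_alt[OF \<tau>])
  let ?g = "\<lambda>S \<theta>. \<integral>x. arcs_lr N \<tau> S \<theta> x * indicator A x \<partial>hc_null N"
  let ?B = "(1 / \<tau>) ^ N"
  have F: "finite F" "F \<noteq> {}"
    using obtain_subset_with_card_n[of K "{1..N}"] K by (auto simp: F_def)
  have AC: "A \<in> sets (\<Pi>\<^sub>M i\<in>{1..N}. circle)" using A by (simp only: sets_hc_null)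
  note [measurable] = A arcs_lr_measurable[OF \<tau>]
  have joint: "(\<lambda>(\<theta>, x). arcs_lr N \<tau> S \<theta> x * indicator A x) \<in> borel_measurable (circ_unif \<Otimes>\<^sub>M hc_null N)" for S
    unfolding case_prod_beta'
    by (rule borel_measurable_times) (use arcs_lr_measurable[OF \<tau>, of N S] in \<open>auto simp: case_prod_beta'\<close>)
  have bnd: "0 \<le> arcs_lr N \<tau> S \<theta> x * indicator A x \<and> arcs_lr N \<tau> S \<theta> x * indicator A x \<le> ?B" for S \<theta> x
    using arcs_lr_bounds[OF \<tau>, of N S \<theta> x] \<tau> by (simp add: indicator_def)
  have meas_x: "arcs_lr N \<tau> S \<theta> \<in> borel_measurable (hc_null N)" if "\<theta> \<in> space circ_unif" for S \<theta>
    using measurable_compose[OF measurable_Pair1'[OF that] arcs_lr_measurable[OF \<tau>]] by simp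
  have int_x: "integrable (hc_null N) (\<lambda>x. arcs_lr N \<tau> S \<theta> x * indicator A x)" if "\<theta> \<in> space circ_unif" for S \<theta>
    using bnd meas_x[OF that] by (intro Q.integrable_const_bound[where B = ?B]) auto
  have g: "emeasure (hc_cond N \<tau> S \<theta>) A = ennreal (?g S \<theta>)" if \<theta>: "\<theta> \<in> space circ_unif" for S \<theta>
  proof -
    have "emeasure (hc_cond N \<tau> S \<theta>) A = (\<integral>\<^sup>+x. ennreal (arcs_lr N \<tau> S \<theta> x) * indicator A x \<partial>hc_null N)"
      using \<theta> meas_x[OF \<theta>] A by (subst hc_cond_eq_density[OF _ \<tau>]) (auto intro: emeasure_density)
    also have "\<dots> = (\<integral>\<^sup>+x. ennreal (arcs_lr N \<tau> S \<theta> x * indicator A x) \<partial>hc_null N)"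
      by (intro nn_integral_cong) (auto simp: indicator_def)
    also have "\<dots> = ennreal (?g S \<theta>)"
      using bnd by (intro nn_integral_eq_integral int_x \<theta>) auto
    finally show ?thesis .
  qed
  have g_bnd: "0 \<le> ?g S \<theta> \<and> ?g S \<theta> \<le> ?B" if \<theta>: "\<theta> \<in> space circ_unif" for S \<theta>
    using bnd by (auto intro!: integral_nonneg_AE Q.integral_le_const int_x \<theta>)
  have g_int: "integrable circ_unif (?g S)" for S
    using g_bnd joint by (intro U.integrable_const_bound[where B = ?B] Q.borel_measurable_lebesgue_integral) auto
  have nn: "0 \<le> (\<integral>\<theta>. ?g S \<theta> \<partial>circ_unif)" for S
    by (rule integral_nonneg_AE[OF AE_I2]) (rule g_bnd[THEN conjunct1])
  have "emeasure (hc_alt N K \<tau>) A = (\<integral>\<^sup>+S. ennreal (\<integral>\<theta>. ?g S \<theta> \<partial>circ_unif) \<partial>measure_pmf (pmf_of_set F))"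
    unfolding emeasure_hc_alt[OF \<tau> AC] F_def[symmetric]
  proof (rule nn_integral_cong)
    fix S
    have "(\<integral>\<^sup>+\<theta>. emeasure (hc_cond N \<tau> S \<theta>) A \<partial>circ_unif) = (\<integral>\<^sup>+\<theta>. ennreal (?g S \<theta>) \<partial>circ_unif)"
      by (rule nn_integral_cong) (rule g)
    also have "\<dots> = ennreal (\<integral>\<theta>. ?g S \<theta> \<partial>circ_unif)"
      using g_bnd by (intro nn_integral_eq_integral g_int) auto
    finally show "(\<integral>\<^sup>+\<theta>. emeasure (hc_cond N \<tau> S \<theta>) A \<partial>circ_unif) = ennreal (\<integral>\<theta>. ?g S \<theta> \<partial>circ_unif)" .
  qed
  also have "\<dots> = ennreal ((\<Sum>S\<in>F. \<integral>\<theta>. ?g S \<theta> \<partial>circ_unif) / card F)"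
  proof -
    show ?thesis
      using F nn by (subst nn_integral_pmf_of_set)
        (auto simp: sum_ennreal divide_ennreal sum_nonneg card_gt_0_iff ennreal_of_nat_eq_real_of_nat)
  qed
  finally have "ennreal (P.prob A) = ennreal ((\<Sum>S\<in>F. \<integral>\<theta>. ?g S \<theta> \<partial>circ_unif) / card F)"
    by (simp only: P.emeasure_eq_measure)
  moreover have "0 \<le> (\<Sum>S\<in>F. \<integral>\<theta>. ?g S \<theta> \<partial>circ_unif) / card F"
    by (intro divide_nonneg_nonneg sum_nonneg nn) simp
  ultimately show ?thesis by simp
qed

lemma hc_alt_bias_le_chi_square_bound:
  assumes \<tau>: "0 < \<tau>" "\<tau> < 1" and KN: "K \<le> N" "0 < N" and A: "A \<in> sets (hc_null N)"
  shows "(measure (hc_alt N K \<tau>) A - measure (hc_null N) A)\<^sup>2 \<le> chi_square_bound N K \<tau>"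
proof -
  define F where "F = {S. S \<subseteq> {1..N} \<and> card S = K}"
  have F: "finite F" "F \<noteq> {}"
    using obtain_subset_with_card_n[of K "{1..N}"] KN by (auto simp: F_def)
  let ?B = "(1 / \<tau>) ^ N"
  let ?U = circ_unif
  have "(measure (hc_alt N K \<tau>) A - measure (hc_null N) A)\<^sup>2
    \<le> (\<Sum>S\<in>F. \<Sum>S'\<in>F. \<integral>\<theta>. \<integral>\<theta>'. \<integral>x. arcs_lr N \<tau> S \<theta> x * arcs_lr N \<tau> S' \<theta>' x
        \<partial>hc_null N \<partial>?U \<partial>?U) / (card F)\<^sup>2 - 1"
    unfolding measure_hc_alt[OF \<tau> KN(1) A] F_def[symmetric]
    using prob_space_uniform_circle prob_space_hc_null F A
  proof (rule mixture_bias_le_chi_square[where B = ?B])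
    show "case_prod (arcs_lr N \<tau> S) \<in> borel_measurable (?U \<Otimes>\<^sub>M hc_null N)" for S
      by (rule arcs_lr_measurable[OF \<tau>])
    show "\<bar>arcs_lr N \<tau> S \<theta> x\<bar> \<le> ?B" for S \<theta> x
      using arcs_lr_bounds[OF \<tau>] by simp
    show "(\<integral>x. arcs_lr N \<tau> S \<theta> x \<partial>hc_null N) = 1" if "\<theta> \<in> space ?U" for S \<theta>
      using that by (intro arcs_lr_mean \<tau>) simp
  qed
  also have "\<dots> \<le> (\<Sum>S\<in>F. \<Sum>S'\<in>F. (1 / \<tau>) ^ (card (S \<inter> S') - 1)) / (card F)\<^sup>2 - 1"
  proof (intro diff_right_mono divide_right_mono sum_mono)
    fix S S' assume S: "S \<in> F" "S' \<in> F"
    have "(\<integral>\<theta>. \<integral>\<theta>'. \<integral>x. arcs_lr N \<tau> S \<theta> x * arcs_lr N \<tau> S' \<theta>' x \<partial>hc_null N \<partial>?U \<partial>?U)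
      = (\<integral>\<theta>. \<integral>\<theta>'. arc_overlap \<tau> \<theta> \<theta>' ^ card (S \<inter> S') \<partial>?U \<partial>?U)"
      using S by (intro Bochner_Integration.integral_cong refl arcs_lr_correlation \<tau>) (auto simp: F_def)
    also have "\<dots> \<le> (1 / \<tau>) ^ (card (S \<inter> S') - 1)" by (rule arc_overlap_moment_le[OF \<tau>])
    finally show "(\<integral>\<theta>. \<integral>\<theta>'. \<integral>x. arcs_lr N \<tau> S \<theta> x * arcs_lr N \<tau> S' \<theta>' x \<partial>hc_null N \<partial>?U \<partial>?U)
      \<le> (1 / \<tau>) ^ (card (S \<inter> S') - 1)" .
  qed simp
  also have "\<dots> \<le> chi_square_bound N K \<tau>"
    unfolding F_def by (rule average_overlap_le[OF \<tau> KN])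
  finally show ?thesis .
qed

text \<open>
  The sum of the errors is \<open>1\<close> minus the bias of the rejection region between the two laws.
\<close>

lemma test_error_ge:
  assumes \<tau>: "0 < \<tau>" "\<tau> < 1" and KN: "K \<le> N" "0 < N" and \<phi>: "is_test N \<phi>"
  shows "p_fa N \<phi> + p_miss N K \<tau> \<phi> \<ge> 1 - sqrt (chi_square_bound N K \<tau>)"
proof -
  interpret P: prob_space "hc_alt N K \<tau>" by (rule prob_space_hc_alt[OF \<tau>])
  define A where "A = {x \<in> space (hc_null N). \<phi> x = 1}"
  have sp: "space (hc_alt N K \<tau>) = space (hc_null N)" "space (hc_null N) = space (\<Pi>\<^sub>M i\<in>{1..N}. circle)"
    by (intro sets_eq_imp_space_eq; simp add: sets_hc_alt[OF \<tau>] sets_hc_null)+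
  have \<phi>m: "\<phi> \<in> (\<Pi>\<^sub>M i\<in>{1..N}. circle) \<rightarrow>\<^sub>M count_space {0, 1}"
    using \<phi> by (simp add: is_test_def)
  have "A = \<phi> -` {1} \<inter> space (\<Pi>\<^sub>M i\<in>{1..N}. circle)"
    by (auto simp: A_def sp)
  also have "\<dots> \<in> sets (\<Pi>\<^sub>M i\<in>{1..N}. circle)"
    by (rule measurable_sets[OF \<phi>m]) auto
  finally have A: "A \<in> sets (\<Pi>\<^sub>M i\<in>{1..N}. circle)" .
  have "\<phi> x \<in> {0, 1}" if "x \<in> space (hc_null N)" for x
    using measurable_space[OF \<phi>m, of x] that by (simp add: sp)
  then have "{x \<in> space (hc_alt N K \<tau>). \<phi> x = 0} = space (hc_alt N K \<tau>) - A"
    by (force simp: A_def sp)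
  then have "p_miss N K \<tau> \<phi> = 1 - P.prob A"
    unfolding p_miss_def using A by (simp add: P.prob_compl sets_hc_alt[OF \<tau>])
  moreover have "p_fa N \<phi> = measure (hc_null N) A"
    by (simp add: p_fa_def A_def)
  moreover have "\<bar>P.prob A - measure (hc_null N) A\<bar> \<le> sqrt (chi_square_bound N K \<tau>)"
    using A by (intro real_le_rsqrt) (simp add: hc_alt_bias_le_chi_square_bound[OF \<tau> KN] sets_hc_null)
  ultimately show ?thesis by linarith
qed

lemma weak_detection_impossible_if_chi_square_bound_tendsto:
  assumes valid: "\<forall>\<^sub>F N in sequentially. 0 < \<tau> N \<and> \<tau> N < 1 \<and> K N \<le> N"
    and lim: "(\<lambda>N. chi_square_bound N (K N) (\<tau> N)) \<longlonglongrightarrow> 0"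
  shows "weak_detection_impossible K \<tau>"
  unfolding weak_detection_impossible_def
proof (intro allI impI exI conjI)
  fix \<phi> :: "nat \<Rightarrow> (nat \<Rightarrow> real) \<Rightarrow> nat"
  assume \<phi>: "\<forall>N. is_test N (\<phi> N)"
  show "(\<lambda>N. sqrt (chi_square_bound N (K N) (\<tau> N))) \<in> o(\<lambda>_. 1)"
    using tendsto_real_sqrt[OF lim] by (intro smalloI_tendsto) auto
  show "\<forall>\<^sub>F N in sequentially. p_fa N (\<phi> N) + p_miss N (K N) (\<tau> N) (\<phi> N)
      \<ge> 1 - sqrt (chi_square_bound N (K N) (\<tau> N))"
    using valid eventually_gt_at_top[of 0]
    by eventually_elim (use \<phi> in \<open>auto intro: test_error_ge\<close>)
qed

section \<open>The two regimes\<close>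

text \<open>
  Write \<open>\<tau> = a * N powr (- 1 - 1 / (K - 1))\<close> with \<open>a \<longlongrightarrow> \<infinity>\<close>. The term of index \<open>r\<close> has denominator
  \<open>N ^ r * \<tau> ^ (r - 1) = a ^ (r - 1) * N powr (1 - (r - 1) / (K - 1))\<close>, which is at least \<open>a\<close> for
  \<open>2 \<le> r \<le> K\<close>. The whole bound is therefore of order \<open>1 / a\<close>.
\<close>

lemma chi_square_bound_fixed_size_tendsto:
  fixes K :: nat and \<tau> :: "nat \<Rightarrow> real"
  assumes K: "2 \<le> K" and \<tau>: "\<forall>\<^sub>F N in sequentially. 0 < \<tau> N \<and> \<tau> N < 1"
    and lim: "filterlim (\<lambda>N. \<tau> N / real N powr (- 1 - 1 / (real K - 1))) at_top sequentially"
  shows "(\<lambda>N. chi_square_bound N K (\<tau> N)) \<longlonglongrightarrow> 0"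
proof -
  define a where "a N = \<tau> N / real N powr (- 1 - 1 / (real K - 1))" for N
  define C where "C = (\<Sum>r = 2..K. ((real K)\<^sup>2) ^ r / fact r)"
  have a: "filterlim a at_top sequentially" using lim unfolding a_def .
  have upper: "\<forall>\<^sub>F N in sequentially. chi_square_bound N K (\<tau> N) \<le> C / a N"
    using eventually_conj[OF \<tau> eventually_conj[OF eventually_gt_at_top[of "0::nat"]
      filterlim_at_top_dense[THEN iffD1, OF a, rule_format, of 1]]]
  proof eventually_elim
    case (elim N)
    then have t: "0 < \<tau> N" and N: "0 < N" and a1: "1 < a N" by auto
    have \<tau>a: "\<tau> N = a N * real N powr (- 1 - 1 / (real K - 1))"
      using N by (simp add: a_def)
    have "\<tau> N * (((real K)\<^sup>2 / (real N * \<tau> N)) ^ r / fact r) \<le> ((real K)\<^sup>2) ^ r / fact r / a N"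
      if r: "r \<in> {2..K}" for r
    proof -
      define d where "d = 1 / (real K - 1)"
      have d: "d * (real r - 1) \<le> 1" using r by (simp add: d_def)
      have "\<tau> N ^ (r - 1) = a N ^ (r - 1) * real N powr ((- 1 - d) * (real r - 1))"
        using r N by (simp add: \<tau>a d_def power_mult_distrib powr_power of_nat_diff mult.commute)
      then have "real N ^ r * \<tau> N ^ (r - 1) = a N ^ (r - 1) * (real N powr real r * real N powr ((- 1 - d) * (real r - 1)))"
        using N by (simp add: powr_realpow)
      also have "\<dots> = a N ^ (r - 1) * real N powr (1 - d * (real r - 1))"
        by (simp add: algebra_simps flip: powr_add)
      finally have eq: "real N ^ r * \<tau> N ^ (r - 1) = a N ^ (r - 1) * real N powr (1 - d * (real r - 1))" .
      have "a N * 1 \<le> a N ^ (r - 1) * real N powr (1 - d * (real r - 1))"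
        using a1 d N r by (intro mult_mono ge_one_powr_ge_zero self_le_power) auto
      then have ge: "a N \<le> real N ^ r * \<tau> N ^ (r - 1)" unfolding eq by simp
      have "\<tau> N * (((real K)\<^sup>2 / (real N * \<tau> N)) ^ r / fact r)
          = ((real K)\<^sup>2) ^ r / fact r / (real N ^ r * \<tau> N ^ (r - 1))"
        using t r by (cases r) (auto simp: power_divide power_mult_distrib)
      also have "\<dots> \<le> ((real K)\<^sup>2) ^ r / fact r / a N"
        using ge a1 t N by (intro divide_left_mono mult_pos_pos) auto
      finally show ?thesis .
    qed
    then show ?case
      unfolding chi_square_bound_def C_def sum_distrib_left sum_divide_distrib by (rule sum_mono)
  qed
  have lower: "\<forall>\<^sub>F N in sequentially. 0 \<le> chi_square_bound N K (\<tau> N)"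
    using \<tau> by eventually_elim (simp add: chi_square_bound_nonneg)
  have "(\<lambda>N. C / a N) \<longlonglongrightarrow> 0"
    by (rule real_tendsto_divide_at_top[OF tendsto_const a])
  then show ?thesis
    by (rule tendsto_sandwich[OF lower upper tendsto_const])
qed

lemma chi_square_bound_le_exp:
  assumes "0 < \<tau>"
  shows "chi_square_bound N K \<tau> \<le> \<tau> * exp ((real K)\<^sup>2 / (real N * \<tau>))"
proof -
  let ?x = "(real K)\<^sup>2 / (real N * \<tau>)"
  have "(\<Sum>r = 2..K. ?x ^ r / fact r) \<le> exp ?x"
    unfolding exp_def using assms
    by (intro order_trans[OF _ sum_le_suminf[OF summable_exp_generic[of ?x], of "{2..K}"]])
       (auto simp: scaleR_conv_of_real divide_inverse mult_ac)
  then show ?thesis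
    using assms unfolding chi_square_bound_def by (intro mult_left_mono) auto
qed


text \<open>
  Rounding \<open>N powr \<alpha>\<close> up or down leaves \<open>1 \<le> K \<le> 2 * N powr \<alpha>\<close>, which explains the constant \<open>4\<close> in the
  majorant \<open>u\<close> of \<open>\<tau> * N powr \<epsilon>\<close> below. The same majorant gives \<open>\<tau> < 1\<close>.
\<close>

lemma
  fixes K :: "nat \<Rightarrow> nat" and \<tau> :: "nat \<Rightarrow> real"
  assumes \<alpha>: "0 < \<alpha>" "\<alpha> < 1 / 2" and \<epsilon>: "0 < \<epsilon>" "\<epsilon> < 1 - 2 * \<alpha>"
    and K: "\<forall>\<^sub>F N in sequentially. K N \<in> {nat \<lfloor>real N powr \<alpha>\<rfloor>, nat \<lceil>real N powr \<alpha>\<rceil>}"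
    and \<tau>: "\<forall>\<^sub>F N in sequentially. \<tau> N = (real (K N))\<^sup>2 / (\<epsilon> * real N * ln (real N))"
  shows polynomial_size_valid: "\<forall>\<^sub>F N in sequentially. 0 < \<tau> N \<and> \<tau> N < 1 \<and> K N \<le> N" (is ?valid)
    and chi_square_bound_polynomial_size_tendsto:
      "(\<lambda>N. chi_square_bound N (K N) (\<tau> N)) \<longlonglongrightarrow> 0" (is ?lim)
proof -
  define u where "u N = 4 * real N powr (2 * \<alpha> - 1 + \<epsilon>) / (\<epsilon> * ln (real N))" for N
  have u: "u \<longlonglongrightarrow> 0"
    unfolding u_def using \<epsilon> by real_asymp
  have main: "\<forall>\<^sub>F N in sequentially. 0 < \<tau> N \<and> K N \<le> N \<and> \<tau> N * real N powr \<epsilon> \<le> u N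
      \<and> (real (K N))\<^sup>2 / (real N * \<tau> N) = \<epsilon> * ln (real N)"
    using K \<tau> eventually_gt_at_top[of 1]
  proof eventually_elim
    case (elim N)
    have N: "1 < real N" using elim by simp
    have l: "0 < ln (real N)" using N by simp
    have p1: "1 \<le> real N powr \<alpha>" using N \<alpha> by (intro ge_one_powr_ge_zero) auto
    have pN: "real N powr \<alpha> \<le> real N" using powr_mono[of \<alpha> 1 "real N"] N \<alpha> by simp
    have "K N \<ge> 1" using elim(1) p1 N by (auto simp: le_nat_iff le_floor_iff le_ceiling_iff)
    moreover have "K N \<le> N"
    proof -
      have "\<lceil>real N powr \<alpha>\<rceil> \<le> int N" "\<lfloor>real N powr \<alpha>\<rfloor> \<le> int N" using pN by linarith+
      then show ?thesis using elim(1) by (auto simp only: insert_iff empty_iff nat_le_iff)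
    qed
    moreover have "real (K N) \<le> 2 * real N powr \<alpha>"
      using elim(1) p1 by auto linarith+
    ultimately have k: "1 \<le> K N" "K N \<le> N" "real (K N) \<le> 2 * real N powr \<alpha>" by auto
    have t: "0 < \<tau> N" unfolding elim(2) using k N l \<epsilon> by simp
    have "(real (K N))\<^sup>2 \<le> (2 * real N powr \<alpha>)\<^sup>2" using k by (intro power_mono) auto
    also have "\<dots> = 4 * real N powr (2 * \<alpha>)"
      by (simp add: power2_eq_square flip: powr_add)
    finally have "(real (K N))\<^sup>2 * real N powr \<epsilon> \<le> 4 * real N powr (2 * \<alpha>) * real N powr \<epsilon>"
      by (intro mult_right_mono) auto
    also have "\<dots> = 4 * real N powr (2 * \<alpha> - 1 + \<epsilon>) * real N"
      using N by (simp add: powr_add powr_diff)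
    finally have "\<tau> N * real N powr \<epsilon> \<le> u N"
      unfolding elim(2) u_def using N l \<epsilon> by (simp add: field_simps)
    moreover have "(real (K N))\<^sup>2 / (real N * \<tau> N) = \<epsilon> * ln (real N)"
      unfolding elim(2) using k N l \<epsilon> by (simp add: field_simps)
    ultimately show ?case using t k by blast
  qed
  have "\<forall>\<^sub>F N in sequentially. u N < 1"
    using order_tendstoD(2)[OF u] by simp
  then show ?valid
    using main eventually_gt_at_top[of 1]
  proof eventually_elim
    case (elim N)
    have "1 \<le> real N powr \<epsilon>" using elim \<epsilon> by (intro ge_one_powr_ge_zero) auto
    then have "\<tau> N * 1 \<le> \<tau> N * real N powr \<epsilon>" using elim by (intro mult_left_mono) auto
    then have "\<tau> N < 1" using elim by linarith
    then show ?case using elim by blast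
  qed
  have upper: "\<forall>\<^sub>F N in sequentially. chi_square_bound N (K N) (\<tau> N) \<le> u N"
    using main eventually_gt_at_top[of 1]
  proof eventually_elim
    case (elim N)
    have "exp (\<epsilon> * ln (real N)) = real N powr \<epsilon>" using elim by (simp add: powr_def)
    then show ?case using chi_square_bound_le_exp[of "\<tau> N" N "K N"] elim by auto
  qed
  have lower: "\<forall>\<^sub>F N in sequentially. 0 \<le> chi_square_bound N (K N) (\<tau> N)"
    using main by eventually_elim (simp add: chi_square_bound_nonneg)
  show ?lim
    by (rule tendsto_sandwich[OF lower upper tendsto_const u])
qed

theorem corollary2:
  shows
    "(\<forall>(K :: nat) (\<tau> :: nat \<Rightarrow> real).
        2 \<le> K \<longrightarrow>
        (\<forall>\<^sub>F N in sequentially. 0 < \<tau> N \<and> \<tau> N < 1) \<longrightarrow>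
        filterlim (\<lambda>N. \<tau> N / real N powr (- 1 - 1 / (real K - 1))) at_top sequentially \<longrightarrow>
        weak_detection_impossible (\<lambda>_. K) \<tau>)
   \<and> (\<forall>(\<alpha> :: real) (\<epsilon> :: real) (K :: nat \<Rightarrow> nat) (\<tau> :: nat \<Rightarrow> real).
        0 < \<alpha> \<longrightarrow> \<alpha> < 1 / 2 \<longrightarrow>
        0 < \<epsilon> \<longrightarrow> \<epsilon> < 1 - 2 * \<alpha> \<longrightarrow>
        (\<forall>\<^sub>F N in sequentially. K N \<in> {nat \<lfloor>real N powr \<alpha>\<rfloor>, nat \<lceil>real N powr \<alpha>\<rceil>}) \<longrightarrow>
        (\<forall>\<^sub>F N in sequentially. \<tau> N = (real (K N))\<^sup>2 / (\<epsilon> * real N * ln (real N))) \<longrightarrow>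
        weak_detection_impossible K \<tau>)"
proof (intro conjI allI impI)
  fix K :: nat and \<tau> :: "nat \<Rightarrow> real"
  assume K: "2 \<le> K" and \<tau>: "\<forall>\<^sub>F N in sequentially. 0 < \<tau> N \<and> \<tau> N < 1"
    and lim: "filterlim (\<lambda>N. \<tau> N / real N powr (- 1 - 1 / (real K - 1))) at_top sequentially"
  have "\<forall>\<^sub>F N in sequentially. 0 < \<tau> N \<and> \<tau> N < 1 \<and> K \<le> N"
    using \<tau> eventually_ge_at_top[of K] by eventually_elim auto
  then show "weak_detection_impossible (\<lambda>_. K) \<tau>"
    by (rule weak_detection_impossible_if_chi_square_bound_tendsto)
       (rule chi_square_bound_fixed_size_tendsto[OF K \<tau> lim])
next
  fix \<alpha> \<epsilon> :: real and K :: "nat \<Rightarrow> nat" and \<tau> :: "nat \<Rightarrow> real"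
  assume "0 < \<alpha>" "\<alpha> < 1 / 2" "0 < \<epsilon>" "\<epsilon> < 1 - 2 * \<alpha>"
    "\<forall>\<^sub>F N in sequentially. K N \<in> {nat \<lfloor>real N powr \<alpha>\<rfloor>, nat \<lceil>real N powr \<alpha>\<rceil>}"
    "\<forall>\<^sub>F N in sequentially. \<tau> N = (real (K N))\<^sup>2 / (\<epsilon> * real N * ln (real N))"
  then show "weak_detection_impossible K \<tau>"
    by (intro weak_detection_impossible_if_chi_square_bound_tendsto)
       (rule polynomial_size_valid chi_square_bound_polynomial_size_tendsto; assumption)+
qed

end
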